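(* Let $F$ be a field with $\operatorname{char}(F)=2$. If $F$ is linked and $I_q^3F=0$, then $u(F)\leq 4$. In particular, if every set of three quaternion algebras over $F$ is linked, then $u(F)\leq 4$.
   Context: Let $F$ be a field of characteristic $2$. For $\alpha\in F$, $\beta\in F^\times$, the quaternion algebra $[\alpha,\beta)_{2,F}$ is the $F$-algebra generated by $x,y$ with relations $x^2+x=\alpha$, $y^2=\beta$, $yxy^{-1}=x+1$; quaternion algebras over $F$ are the algebras of this form (the split algebra is included). Its norm form is the quadratic $2$-fold Pfister form $\langle\langle\beta,\alpha]]=\langle 1,\beta\rangle\otimes[1,\alpha]$, where $[1,\alpha]$ is the quadratic form $x^2+xy+\alpha y^2$ and $\langle 1,\beta\rangle$ is a diagonal bilinear form. A bilinear $1$-fold Pfister form is a form $\langle 1,a\rangle$ with $a\in F^\times$; a quadratic $1$-fold Pfister form is a form $[1,b]$ with $b\in F$. A set of quaternion algebras $Q_1,\dots,Q_m$ (repetitions allowed) with norm forms $\varphi_1,\dots,\varphi_m$ is linked if the forms $\varphi_i$ have a common quadratic or bilinear $1$-fold Pfister factor, that is: either there are a quadratic $1$-fold Pfister form $\phi$ and bilinear $1$-fold Pfister forms $B_i$ with $\varphi_i\cong B_i\otimes\phi$ for all $i$, or there are a bilinear $1$-fold Pfister form $B$ and quadratic $1$-fold Pfister forms $\phi_i$ with $\varphi_i\cong B\otimes\phi_i$ for all $i$. In terms of algebras, this is the condition that the $Q_i$ share a common maximal subfield. The field $F$ is called linked if every two quaternion algebras over $F$ are linked. $I_qF=W_qF$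 is the group of Witt classes of nonsingular quadratic forms over $F$ under orthogonal sum. $I_q^3F$ is its subgroup generated by the classes of scalar multiples of quadratic $3$-fold Pfister forms $\langle 1,a\rangle\otimes\langle 1,b\rangle\otimes[1,c]$, $a,b\in F^\times$, $c\in F$. A quadratic form is nonsingular if its polar form is nondegenerate. $u(F)$ is the supremum of the dimensions of nonsingular anisotropic quadratic forms over $F$ of finite order in $W_qF$ (in characteristic $2$ every class has finite order). *)

theory Defs
  imports
    "Jordan_Normal_Form.VS_Connect"
    "HOL-Algebra.Generated_Groups"
    "HOL-Library.Extended_Nat"
begin

section \<open>Quadratic forms\<close>

text \<open>
  A form of dimension n is a function on \<open>carrier_vec n\<close>. Its values off that carrier
  are irrelevant: everything below (isometry in particular) only inspects \<open>carrier_vec n\<close>.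
\<close>

record 'a qform =
  qdim :: nat
  qval :: "'a vec \<Rightarrow> 'a"

definition polar :: "'a::field qform \<Rightarrow> 'a vec \<Rightarrow> 'a vec \<Rightarrow> 'a" where
  "polar q v w = qval q (v + w) - qval q v - qval q w"

definition quadratic_form :: "'a::field qform \<Rightarrow> bool" where
  "quadratic_form q \<longleftrightarrow>
     (\<forall>c. \<forall>v \<in> carrier_vec (qdim q). qval q (c \<cdot>\<^sub>v v) = c\<^sup>2 * qval q v) \<and>
     (\<forall>u \<in> carrier_vec (qdim q). \<forall>v \<in> carrier_vec (qdim q). \<forall>w \<in> carrier_vec (qdim q).
        polar q (u + v) w = polar q u w + polar q v w) \<and>
     (\<forall>c. \<forall>v \<in> carrier_vec (qdim q). \<forall>w \<in> carrier_vec (qdim q).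
        polar q (c \<cdot>\<^sub>v v) w = c * polar q v w)"

definition nonsingular :: "'a::field qform \<Rightarrow> bool" where
  "nonsingular q \<longleftrightarrow> quadratic_form q \<and>
     (\<forall>v \<in> carrier_vec (qdim q).
        (\<forall>w \<in> carrier_vec (qdim q). polar q v w = 0) \<longrightarrow> v = 0\<^sub>v (qdim q))"

definition anisotropic :: "'a::field qform \<Rightarrow> bool" where
  "anisotropic q \<longleftrightarrow>
     (\<forall>v \<in> carrier_vec (qdim q). qval q v = 0 \<longrightarrow> v = 0\<^sub>v (qdim q))"

definition isometric :: "'a::field qform \<Rightarrow> 'a qform \<Rightarrow> bool" (infix \<open>\<cong>\<^sub>q\<close> 50) where
  "p \<cong>\<^sub>q q \<longleftrightarrow> qdim p = qdim q \<and>
     (\<exists>P \<in> carrier_mat (qdim p) (qdim p). invertible_mat P \<and>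
        (\<forall>v \<in> carrier_vec (qdim p). qval q (P *\<^sub>v v) = qval p v))"

definition zero_form :: "'a::field qform" where
  "zero_form = \<lparr>qdim = 0, qval = (\<lambda>_. 0)\<rparr>"

definition orth_sum :: "'a::field qform \<Rightarrow> 'a qform \<Rightarrow> 'a qform" (infixr \<open>\<bottom>\<^sub>q\<close> 65) where
  "p \<bottom>\<^sub>q q = \<lparr>qdim = qdim p + qdim q,
     qval = (\<lambda>v. qval p (vec_first v (qdim p)) + qval q (vec_last v (qdim q)))\<rparr>"

definition scale_form :: "'a::field \<Rightarrow> 'a qform \<Rightarrow> 'a qform" where
  "scale_form c q = \<lparr>qdim = qdim q, qval = (\<lambda>v. c * qval q v)\<rparr>"

text \<open>The binary form \<open>[a,b]\<close>, that is \<open>a x\<^sup>2 + x y + b y\<^sup>2\<close>.\<close>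

definition binary_form :: "'a::field \<Rightarrow> 'a \<Rightarrow> 'a qform" where
  "binary_form a b = \<lparr>qdim = 2, qval = (\<lambda>v. a * (v $ 0)\<^sup>2 + v $ 0 * v $ 1 + b * (v $ 1)\<^sup>2)\<rparr>"

text \<open>
  The diagonal bilinear form with entries \<open>a\<^sub>1, \<dots>, a\<^sub>n\<close> is represented by the list of
  its entries. Its tensor product with a quadratic form \<open>q\<close> is the quadratic form
  \<open>a\<^sub>1 q \<bottom> \<dots> \<bottom> a\<^sub>n q\<close>.
\<close>

definition diag_tensor :: "'a::field list \<Rightarrow> 'a qform \<Rightarrow> 'a qform" where
  "diag_tensor as q = foldr (\<lambda>a r. scale_form a q \<bottom>\<^sub>q r) as zero_form"

definition bilinear_pfister_1 :: "'a::field list \<Rightarrow> bool" where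
  "bilinear_pfister_1 B \<longleftrightarrow> (\<exists>a. a \<noteq> 0 \<and> B = [1, a])"

definition quadratic_pfister_1 :: "'a::field qform \<Rightarrow> bool" where
  "quadratic_pfister_1 q \<longleftrightarrow> (\<exists>b. q = binary_form 1 b)"

text \<open>\<open>pfister [a\<^sub>1, \<dots>, a\<^sub>n] c\<close> is \<open>\<langle>1,a\<^sub>1\<rangle> \<otimes> \<dots> \<otimes> \<langle>1,a\<^sub>n\<rangle> \<otimes> [1,c]\<close>.\<close>

definition pfister :: "'a::field list \<Rightarrow> 'a \<Rightarrow> 'a qform" where
  "pfister as c = foldr (\<lambda>a q. diag_tensor [1, a] q) as (binary_form 1 c)"


section \<open>The Witt group of nonsingular quadratic forms\<close>

text \<open>
  Two nonsingular forms are Witt equivalent if they become isometric after adding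
  hyperbolic planes \<open>[0,0]\<close>, i.e. \<open>x y\<close>, to both.
\<close>

definition hyperbolic :: "nat \<Rightarrow> 'a::field qform" where
  "hyperbolic m = diag_tensor (replicate m 1) (binary_form 0 0)"

definition witt_rel :: "('a::field qform \<times> 'a qform) set" where
  "witt_rel = {(p, q). nonsingular p \<and> nonsingular q \<and>
     (\<exists>m n. p \<bottom>\<^sub>q hyperbolic m \<cong>\<^sub>q q \<bottom>\<^sub>q hyperbolic n)}"

definition witt_class :: "'a::field qform \<Rightarrow> 'a qform set" where
  "witt_class q = witt_rel `` {q}"

definition witt_group :: "'a::field qform set monoid" where
  "witt_group = \<lparr>carrier = {q. nonsingular q} // witt_rel,
     mult = (\<lambda>X Y. \<Union>p\<in>X. \<Union>q\<in>Y. witt_class (p \<bottom>\<^sub>q q)),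
     one = witt_class zero_form\<rparr>"

definition I3q :: "'a::field qform set set" where
  "I3q = generate witt_group
     {witt_class (scale_form d (pfister [a, b] c)) | a b c d. a \<noteq> 0 \<and> b \<noteq> 0 \<and> d \<noteq> 0}"

text \<open>
  In \<open>enat\<close> the supremum of an unbounded set is \<open>\<infinity>\<close>. The zero-dimensional form belongs
  to the set.
\<close>

definition u_invariant :: "'a::field itself \<Rightarrow> enat" where
  "u_invariant _ = Sup {enat (qdim q) | q :: 'a qform. nonsingular q \<and> anisotropic q \<and>
     (\<exists>n::nat. n > 0 \<and> witt_class q [^]\<^bsub>witt_group\<^esub> n = \<one>\<^bsub>witt_group\<^esub>)}"


section \<open>Quaternion algebras in characteristic 2\<close>

text \<open>The locale \<open>algebra\<close> of HOL-Algebra requires commutativity.\<close>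

definition F_algebra :: "('a::field, 'b) module \<Rightarrow> bool" where
  "F_algebra A \<longleftrightarrow> ring A \<and> Module.module (class_ring :: 'a ring) A \<and>
     (\<forall>c. \<forall>u \<in> carrier A. \<forall>v \<in> carrier A.
        (c \<odot>\<^bsub>A\<^esub> u) \<otimes>\<^bsub>A\<^esub> v = c \<odot>\<^bsub>A\<^esub> (u \<otimes>\<^bsub>A\<^esub> v) \<and>
        u \<otimes>\<^bsub>A\<^esub> (c \<odot>\<^bsub>A\<^esub> v) = c \<odot>\<^bsub>A\<^esub> (u \<otimes>\<^bsub>A\<^esub> v))"

definition quaternion_rels :: "('a::field, 'b) module \<Rightarrow> 'a \<Rightarrow> 'a \<Rightarrow> 'b \<Rightarrow> 'b \<Rightarrow> bool" where
  "quaternion_rels A \<alpha> \<beta> x y \<longleftrightarrow> x \<in> carrier A \<and> y \<in> Units A \<and>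
     x \<otimes>\<^bsub>A\<^esub> x \<oplus>\<^bsub>A\<^esub> x = \<alpha> \<odot>\<^bsub>A\<^esub> \<one>\<^bsub>A\<^esub> \<and>
     y \<otimes>\<^bsub>A\<^esub> y = \<beta> \<odot>\<^bsub>A\<^esub> \<one>\<^bsub>A\<^esub> \<and>
     y \<otimes>\<^bsub>A\<^esub> x \<otimes>\<^bsub>A\<^esub> inv\<^bsub>A\<^esub> y = x \<oplus>\<^bsub>A\<^esub> \<one>\<^bsub>A\<^esub>"

definition quaternion_elt :: "('a::field, 'b) module \<Rightarrow> 'b \<Rightarrow> 'b \<Rightarrow> 'a \<times> 'a \<times> 'a \<times> 'a \<Rightarrow> 'b" where
  "quaternion_elt A x y = (\<lambda>(a, b, c, d).
     a \<odot>\<^bsub>A\<^esub> \<one>\<^bsub>A\<^esub> \<oplus>\<^bsub>A\<^esub> b \<odot>\<^bsub>A\<^esub> x \<oplus>\<^bsub>A\<^esub> c \<odot>\<^bsub>A\<^esub> y \<oplus>\<^bsub>A\<^esub> d \<odot>\<^bsub>A\<^esub> (x \<otimes>\<^bsub>A\<^esub> y))"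

text \<open>
  \<open>A\<close> is the algebra \<open>[\<alpha>,\<beta>)\<close> on the generators \<open>x\<close>, \<open>y\<close>. The relations rewrite every word in
  \<open>x\<close>, \<open>y\<close> to a combination of \<open>1, x, y, xy\<close>. That no further relations hold is expressed by
  requiring these four to be a basis.
\<close>

definition quaternion_presentation ::
    "('a::field, 'b) module \<Rightarrow> 'a \<Rightarrow> 'a \<Rightarrow> 'b \<Rightarrow> 'b \<Rightarrow> bool" where
  "quaternion_presentation A \<alpha> \<beta> x y \<longleftrightarrow> F_algebra A \<and> \<beta> \<noteq> 0 \<and>
     quaternion_rels A \<alpha> \<beta> x y \<and> bij_betw (quaternion_elt A x y) UNIV (carrier A)"

definition quaternion_algebra :: "('a::field, 'b) module \<Rightarrow> bool" where
  "quaternion_algebra A \<longleftrightarrow> (\<exists>\<alpha> \<beta> x y. quaternion_presentation A \<alpha> \<beta> x y)"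

text \<open>
  On \<open>a + b x + c y + d x y\<close> the form \<open>\<langle>1,\<beta>\<rangle> \<otimes> [1,\<alpha>]\<close> takes the value
  \<open>a\<^sup>2 + a b + \<alpha> b\<^sup>2 + \<beta> (c\<^sup>2 + c d + \<alpha> d\<^sup>2)\<close>, the reduced norm.
\<close>

definition norm_form_of :: "('a::field, 'b) module \<Rightarrow> 'a qform \<Rightarrow> bool" where
  "norm_form_of A \<phi> \<longleftrightarrow>
     (\<exists>\<alpha> \<beta> x y. quaternion_presentation A \<alpha> \<beta> x y \<and> \<phi> \<cong>\<^sub>q pfister [\<beta>] \<alpha>)"

definition common_pfister_factor :: "'a::field qform list \<Rightarrow> bool" where
  "common_pfister_factor \<phi>s \<longleftrightarrow>
     (\<exists>\<psi>. quadratic_pfister_1 \<psi> \<and>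
        (\<forall>\<phi> \<in> set \<phi>s. \<exists>B. bilinear_pfister_1 B \<and> \<phi> \<cong>\<^sub>q diag_tensor B \<psi>)) \<or>
     (\<exists>B. bilinear_pfister_1 B \<and>
        (\<forall>\<phi> \<in> set \<phi>s. \<exists>\<psi>. quadratic_pfister_1 \<psi> \<and> \<phi> \<cong>\<^sub>q diag_tensor B \<psi>))"

text \<open>Norm forms are determined up to isometry, so the choice of \<open>\<phi>s\<close> is immaterial.\<close>

definition linked :: "('a::field, 'b) module list \<Rightarrow> bool" where
  "linked Qs \<longleftrightarrow> (\<exists>\<phi>s. list_all2 norm_form_of Qs \<phi>s \<and> common_pfister_factor \<phi>s)"

text \<open>
  Linkage depends only on the isomorphism classes of the algebras, and by
  \<open>quaternion_presentation_exists\<close> below every quaternion algebra over \<open>F\<close> has a copy with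
  carrier type \<open>F\<^sup>4\<close>. So nothing is lost by quantifying over algebras of that type.
\<close>

definition all_quaternion_linked :: "nat \<Rightarrow> 'a::field itself \<Rightarrow> bool" where
  "all_quaternion_linked m _ \<longleftrightarrow> (\<forall>Qs :: ('a, 'a \<times> 'a \<times> 'a \<times> 'a) module list.
     length Qs = m \<and> (\<forall>Q \<in> set Qs. quaternion_algebra Q) \<longrightarrow> linked Qs)"

definition linked_field :: "'a::field itself \<Rightarrow> bool" where
  "linked_field F \<longleftrightarrow> all_quaternion_linked 2 F"


definition quaternion_model :: "'a::field \<Rightarrow> 'a \<Rightarrow> ('a, 'a \<times> 'a \<times> 'a \<times> 'a) module" where
  "quaternion_model \<alpha> \<beta> = \<lparr>carrier = UNIV,
     mult = (\<lambda>(a, b, c, d) (a', b', c', d').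
       (a * a' + \<alpha> * b * b' + \<beta> * (c * (c' + d') + \<alpha> * d * d'),
        a * b' + b * a' + b * b' + \<beta> * (c * d' + d * c'),
        a * c' + \<alpha> * b * d' + c * (a' + b') + \<alpha> * d * b',
        a * d' + b * c' + b * d' + c * b' + d * a')),
     one = (1, 0, 0, 0), zero = (0, 0, 0, 0),
     add = (\<lambda>(a, b, c, d) (a', b', c', d'). (a + a', b + b', c + c', d + d')),
     smult = (\<lambda>r (a, b, c, d). (r * a, r * b, r * c, r * d))\<rparr>"

lemma CHAR_2_add_self:
  assumes "CHAR('a::field) = 2"
  shows "(a::'a) + a = 0"
proof -
  have "(2::'a) = 0"
    using of_nat_CHAR[where 'a='a] assms by simp
  then show ?thesis
    by (metis mult_2 mult_zero_left)
qed

lemma quaternion_presentation_exists: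
  assumes char: "CHAR('a::field) = 2" and \<beta>: "(\<beta>::'a) \<noteq> 0"
  shows "quaternion_presentation (quaternion_model \<alpha> \<beta>) \<alpha> \<beta> (0, 1, 0, 0) (0, 0, 1, 0)"
proof -
  let ?A = "quaternion_model \<alpha> \<beta>"
  have neg: "- a = a" for a :: 'a
    using CHAR_2_add_self[OF char, of a] by (simp add: add_eq_0_iff)
  have dbl: "a + a = 0" "a + (a + b) = b" for a b :: 'a
    using CHAR_2_add_self[OF char, of a] by (simp_all add: add.assoc [symmetric])
  have ab: "abelian_group ?A"
  proof (rule abelian_groupI)
    fix u assume "u \<in> carrier ?A"
    then show "\<exists>v\<in>carrier ?A. v \<oplus>\<^bsub>?A\<^esub> u = \<zero>\<^bsub>?A\<^esub>"
      by (intro bexI[of _ u]) (auto simp: quaternion_model_def dbl split: prod.splits)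
  qed (auto simp: quaternion_model_def algebra_simps)
  have mon: "monoid ?A"
    by (rule monoidI) (auto simp: quaternion_model_def algebra_simps dbl)
  have ring: "ring ?A"
    by (rule ringI[OF ab mon]) (auto simp: quaternion_model_def algebra_simps dbl)
  have md: "Module.module (class_ring :: 'a ring) ?A"
    by (rule moduleI[OF _ ab])
      (auto simp: quaternion_model_def algebra_simps dbl intro: class_cring.is_cring)
  have alg: "F_algebra ?A"
    unfolding F_algebra_def using ring md by (auto simp: quaternion_model_def algebra_simps)
  interpret A: monoid ?A by (rule mon)
  let ?x = "(0, 1, 0, 0) :: 'a \<times> 'a \<times> 'a \<times> 'a"
  let ?y = "(0, 0, 1, 0) :: 'a \<times> 'a \<times> 'a \<times> 'a"
  let ?i = "(0, 0, inverse \<beta>, 0) :: 'a \<times> 'a \<times> 'a \<times> 'a"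
  have yi: "?y \<otimes>\<^bsub>?A\<^esub> ?i = \<one>\<^bsub>?A\<^esub>" "?i \<otimes>\<^bsub>?A\<^esub> ?y = \<one>\<^bsub>?A\<^esub>"
    using \<beta> by (auto simp: quaternion_model_def)
  have U: "?y \<in> Units ?A"
    unfolding Units_def
    by (intro CollectI conjI bexI[of _ ?i] yi) (simp_all add: quaternion_model_def)
  have inv: "inv\<^bsub>?A\<^esub> ?y = ?i"
    using A.inv_char[OF _ _ yi] by (simp add: quaternion_model_def)
  have rels: "quaternion_rels ?A \<alpha> \<beta> ?x ?y"
    unfolding quaternion_rels_def inv using U \<beta>
    by (auto simp: quaternion_model_def dbl split: prod.splits)
  have elt: "quaternion_elt ?A ?x ?y = id"
    by (auto simp: quaternion_elt_def quaternion_model_def)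
  show ?thesis
    unfolding quaternion_presentation_def using alg \<beta> rels
    by (simp add: elt) (simp add: quaternion_model_def bij_id [unfolded id_def])
qed

end

(*
  Everything is reduced to one count. If a form is the orthogonal sum of f and m hyperbolic planes
  and contains a totally isotropic space of dimension greater than m, then f is isotropic. This
  replaces all computations in the Witt group.

  Write n_a for [1,a]. Suppose that all 3-fold Pfister forms are isotropic, so that norm forms of
  quaternion algebras are universal. A common factor of the norm forms of [a1,b1) and [a2,b2) gives
  a 3-dimensional totally isotropic space in n_a1 + b1 n_a1 + n_a2 + b2 n_a2 + <1>, and n_a1 + n_a2
  + <1> is <1> plus two hyperbolic planes, so b1 n_a1 + b2 n_a2 + <1> is isotropic. Up to a
  scalar, every nonsingular anisotropic form of dimension at least 5 contains such a form.

  If all triples are linked, then a 3-fold Pfister form, written as <1,b> * <1,z^2+f> * n_f after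
  changing its last slot, is isotropic: put e = z^2+f and take Q1 = [f z^2/e, A), Q2 = [f^2/e, A),
  Q3 = [f, b) with A = f z^2/(b e). Any two of them share an inseparable quadratic extension. If
  [g,e1), [g,e2), [g,e3) are presentations with a common g, this forces each sum ei n_g + ej n_g to
  represent 1, hence so does e1 e2 n_g + e3 n_g. That yields a 5-dimensional totally isotropic space
  in the sum of the three norm forms and <1>, which is A n_f + b n_f + <1> plus four hyperbolic
  planes; and this 5-dimensional form is a subform of the Pfister form. A common inseparable
  extension gives such a space directly.
*)
theory Submission
  imports Defs
begin

section \<open>Isotropy from large totally isotropic spaces\<close>

definition linear_functional :: "((nat \<Rightarrow> 'a::field) \<Rightarrow> 'a) \<Rightarrow> bool" where
  "linear_functional r \<longleftrightarrow>
     (\<forall>c d. r (\<lambda>i. c i + d i) = r c + r d) \<and> (\<forall>k c. r (\<lambda>i. k * c i) = k * r c)"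

lemma linear_functional_add: "linear_functional r \<Longrightarrow> r (\<lambda>i. c i + d i) = r c + r d"
  by (simp add: linear_functional_def)

lemma linear_functional_scale: "linear_functional r \<Longrightarrow> r (\<lambda>i. k * c i) = k * r c"
  by (simp add: linear_functional_def)

lemma linear_functional_zero:
  assumes "linear_functional r"
  shows "r (\<lambda>_. 0) = 0"
  using linear_functional_scale[OF assms, of 0 "\<lambda>_. 0"] by simp

lemma linear_functional_expand:
  assumes r: "linear_functional r" and "finite I" and "\<And>i. i \<notin> I \<Longrightarrow> c i = 0"
  shows "r c = (\<Sum>i\<in>I. c i * r (\<lambda>j. if j = i then 1 else 0))"
  using assms(2,3)
proof (induction I arbitrary: c rule: finite_induct)
  case empty
  then have "c = (\<lambda>_. 0)" by auto
  then show ?case using linear_functional_zero[OF r] by simp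
next
  case (insert i I)
  have "c = (\<lambda>j. (c(i := 0)) j + c i * (if j = i then 1 else 0))" by auto
  then have "r c = r (c(i := 0)) + c i * r (\<lambda>j. if j = i then 1 else 0)"
    using linear_functional_add[OF r] linear_functional_scale[OF r] by metis
  also have "r (c(i := 0)) = (\<Sum>k\<in>I. (c(i := 0)) k * r (\<lambda>j. if j = k then 1 else 0))"
    by (rule insert.IH) (use insert.prems in auto)
  also have "\<dots> = (\<Sum>k\<in>I. c k * r (\<lambda>j. if j = k then 1 else 0))"
    by (rule sum.cong) (use insert.hyps in auto)
  finally show ?case using insert.hyps by (simp add: add.commute)
qed

text \<open>Gaussian elimination. Parameters are functions on all of \<open>nat\<close>, so the
  dimension sits in the finite support \<open>I\<close>; the functionals form a list so that its
  length counts the equations.\<close>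

lemma common_kernel_nontrivial:
  assumes "\<And>r. r \<in> set rs \<Longrightarrow> linear_functional r" and "finite I" and "length rs < card I"
  obtains c where "\<And>r. r \<in> set rs \<Longrightarrow> r c = 0" and "\<And>i. i \<notin> I \<Longrightarrow> c i = 0" and "\<exists>i. c i \<noteq> 0"
proof -
  have "\<exists>c. (\<forall>r\<in>set rs. r c = 0) \<and> (\<forall>i. i \<notin> I \<longrightarrow> c i = 0) \<and> (\<exists>i. c i \<noteq> 0)"
    using assms
  proof (induction "length rs" arbitrary: rs I)
    case 0
    then obtain i where "i \<in> I" by fastforce
    then show ?case using 0 by (intro exI[of _ "\<lambda>j. if j = i then 1 else 0"]) auto
  next
    case (Suc m)
    then obtain s ts where rs: "rs = s # ts" and len: "length ts = m"
      by (metis length_Suc_conv)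
    have s: "linear_functional s" and ts: "\<And>r. r \<in> set ts \<Longrightarrow> linear_functional r"
      using Suc.prems rs by auto
    let ?u = "\<lambda>i j. if j = i then 1 else (0::'a)"
    show ?case
    proof (cases "\<exists>j\<in>I. s (?u j) \<noteq> 0")
      \<comment> \<open>\<open>s\<close> kills every unit vector of \<open>I\<close>, hence
        everything supported on \<open>I\<close>, and imposes no condition.\<close>
      case False
      obtain c where c: "\<forall>r\<in>set ts. r c = 0" "\<forall>i. i \<notin> I \<longrightarrow> c i = 0" "\<exists>i. c i \<noteq> 0"
        using Suc.hyps(1)[OF len[symmetric] ts Suc.prems(2)] Suc.prems(3) rs by fastforce
      then have "s c = 0"
        using linear_functional_expand[OF s Suc.prems(2), of c] False by auto
      then show ?thesis using c rs by auto
    next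
      case True
      then obtain j where j: "j \<in> I" "s (?u j) \<noteq> 0" by auto
      \<comment> \<open>\<open>E\<close> is the projection onto the kernel of \<open>s\<close> along
        the unit vector at the pivot \<open>j\<close>. Composing the remaining functionals with it
        eliminates one equation and one coordinate.\<close>
      define E where "E c = (\<lambda>i. c i + (- s c / s (?u j)) * ?u j i)" for c
      have rE: "r (E c) = r c + (- s c / s (?u j)) * r (?u j)" if "linear_functional r" for r c
        unfolding E_def using linear_functional_add[OF that] linear_functional_scale[OF that] by metis
      have lin: "linear_functional (\<lambda>c. r (E c))" if "linear_functional r" for r
        using that s unfolding rE[OF that] linear_functional_def
        by (auto simp: algebra_simps add_divide_distrib diff_divide_distrib)
      obtain c where c: "\<forall>r\<in>set (map (\<lambda>r c. r (E c)) ts). r c = 0"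
        "\<forall>i. i \<notin> I - {j} \<longrightarrow> c i = 0" "\<exists>i. c i \<noteq> 0"
        using Suc.hyps(1)[of "map (\<lambda>r c. r (E c)) ts" "I - {j}"] lin ts len Suc.prems(2,3) rs j
        by fastforce
      have "s (E c) = 0" using rE[OF s] j by simp
      moreover obtain i where "c i \<noteq> 0" using c(3) by auto
      with c(2) have "E c i \<noteq> 0" by (auto simp: E_def)
      moreover have "\<forall>i. i \<notin> I \<longrightarrow> E c i = 0" using c(2) j by (auto simp: E_def)
      ultimately show ?thesis using c(1) rs by (intro exI[of _ "E c"]) auto
    qed
  qed
  then show ?thesis using that by auto
qed

text \<open>
  The totally isotropic space has parameters \<open>c\<^sub>0, \<dots>, c\<^bsub>k-1\<^esub>\<close>, and \<open>X, Y\<close> are the coordinates on the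
  hyperbolic planes. \<open>Z c\<close> says that the \<open>f\<close>-component of the vector with parameter \<open>c\<close> vanishes.
  Each plane costs one linear condition, \<open>X = 0\<close> or \<open>Y = 0\<close>.
\<close>

lemma isotropic_if_large_isotropic_space:
  fixes f :: "(nat \<Rightarrow> 'a::field) \<Rightarrow> 'a"
  assumes lin: "\<And>X Y. (X, Y) \<in> set XYs \<Longrightarrow> linear_functional X \<and> linear_functional Y"
    and zero: "\<And>c. f c + (\<Sum>(X, Y)\<leftarrow>XYs. X c * Y c) = 0"
    and translate: "\<And>c d. Z c \<Longrightarrow> f (\<lambda>i. c i + d i) = f d"
    and inj: "\<And>c i. Z c \<Longrightarrow> (\<And>X Y. (X, Y) \<in> set XYs \<Longrightarrow> X c = 0 \<and> Y c = 0) \<Longrightarrow> i < k \<Longrightarrow> c i = 0"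
    and dim: "length XYs < k"
  obtains c where "f c = 0" and "\<not> Z c"
proof -
  \<comment> \<open>Induction invariant: on the common kernel of the conditions \<open>rs\<close>
    imposed so far, \<open>zero\<close> and \<open>inj\<close> hold for the planes still in the
    list.\<close>
  define ok where "ok rs XYs f Z \<longleftrightarrow> (\<forall>r\<in>set rs. linear_functional r) \<and>
      (\<forall>c. (\<forall>r\<in>set rs. r c = 0) \<longrightarrow> f c + (\<Sum>(X, Y)\<leftarrow>XYs. X c * Y c) = 0) \<and>
      (\<forall>c. (\<forall>r\<in>set rs. r c = 0) \<longrightarrow> Z c \<longrightarrow> (\<forall>(X, Y)\<in>set XYs. X c = 0 \<and> Y c = 0) \<longrightarrow>
         (\<forall>i<k. c i = 0))"
    for rs XYs and f :: "(nat \<Rightarrow> 'a) \<Rightarrow> 'a" and Z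
  have "\<exists>rs'. length rs' = length rs + length XYs \<and> ok rs' [] f Z"
    if "\<forall>(X, Y)\<in>set XYs. linear_functional X \<and> linear_functional Y"
      and "\<forall>c d. Z c \<longrightarrow> f (\<lambda>i. c i + d i) = f d" and "ok rs XYs f Z" for XYs rs
    using that
  proof (induction XYs arbitrary: rs)
    case Nil
    then show ?case by auto
  next
    case (Cons XY XYs)
    obtain X Y where XY: "XY = (X, Y)" by fastforce
    have linX: "linear_functional X" and linY: "linear_functional Y"
      and linr: "\<forall>r\<in>set rs. linear_functional r"
      using Cons.prems XY by (auto simp: ok_def)
    let ?f = "\<lambda>c. f c + (\<Sum>(X, Y)\<leftarrow>XYs. X c * Y c)"
    let ?Z = "\<lambda>c. Z c \<and> (\<forall>(X, Y)\<in>set XYs. X c = 0 \<and> Y c = 0)"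
    have eq: "?f c = - (X c * Y c)" if "\<forall>r\<in>set rs. r c = 0" for c
    proof -
      have "f c + (X c * Y c + (\<Sum>(X, Y)\<leftarrow>XYs. X c * Y c)) = 0"
        using Cons.prems(3) that by (simp add: ok_def XY)
      then show ?thesis by (simp add: eq_neg_iff_add_eq_0 algebra_simps)
    qed
    have inj: "\<forall>i<k. c i = 0" if "\<forall>r\<in>set rs. r c = 0" "?Z c" "X c = 0" "Y c = 0" for c
      using Cons.prems(3) that by (auto simp: ok_def XY)
    have tr: "?f (\<lambda>i. c i + d i) = ?f d" if "?Z c" for c d
    proof -
      have "(\<Sum>(X, Y)\<leftarrow>XYs. X (\<lambda>i. c i + d i) * Y (\<lambda>i. c i + d i)) = (\<Sum>(X, Y)\<leftarrow>XYs. X d * Y d)"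
      proof (rule arg_cong[where f = sum_list], rule map_cong[OF refl])
        fix p assume p: "p \<in> set XYs"
        obtain U V where UV: "p = (U, V)" by fastforce
        then have "linear_functional U" "linear_functional V" "U c = 0" "V c = 0"
          using Cons.prems(1) that p by auto
        then show "(case p of (X, Y) \<Rightarrow> X (\<lambda>i. c i + d i) * Y (\<lambda>i. c i + d i))
            = (case p of (X, Y) \<Rightarrow> X d * Y d)"
          by (simp add: UV linear_functional_add[of U] linear_functional_add[of V])
      qed
      then show ?thesis using Cons.prems(2) that by simp
    qed
    have "\<exists>r. linear_functional r \<and> ok (r # rs) XYs f Z"
    \<comment> \<open>\<open>z\<close> is a nonzero vector of the space lying on the isotropic line
      \<open>Y = 0\<close> of this plane. If it exists, the space is orthogonal to it, so
      \<open>Y\<close> vanishes identically and \<open>X = 0\<close> can be imposed. Otherwise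
      imposing \<open>Y = 0\<close> keeps injectivity after the plane is forgotten.\<close>
    proof (cases "\<exists>z. (\<forall>r\<in>set rs. r z = 0) \<and> ?Z z \<and> Y z = 0 \<and> \<not> (\<forall>i<k. z i = 0)")
      case True
      then obtain z where z: "\<forall>r\<in>set rs. r z = 0" "?Z z" "Y z = 0" "X z \<noteq> 0"
        using inj by blast
      \<comment> \<open>Translation by \<open>z\<close> does not change \<open>?f\<close>, so
        \<open>X * Y\<close> takes the same value at \<open>c\<close> and at \<open>z + c\<close>;
        the difference is \<open>X z * Y c\<close>, and \<open>X z\<close> is nonzero.\<close>
      have Y0: "Y c = 0" if c: "\<forall>r\<in>set rs. r c = 0" for c
      proof -
        have "\<forall>r\<in>set rs. r (\<lambda>i. z i + c i) = 0"
        proof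
          fix r assume r: "r \<in> set rs"
          then have "r z = 0" "r c = 0" using z(1) c by auto
          then show "r (\<lambda>i. z i + c i) = 0"
            using linear_functional_add[of r z c] linr r by simp
        qed
        then have "- (X (\<lambda>i. z i + c i) * Y (\<lambda>i. z i + c i)) = - (X c * Y c)"
          using eq[of "\<lambda>i. z i + c i"] eq[OF c] tr[OF z(2), of c] by simp
        then show ?thesis
          using z by (simp add: linear_functional_add[OF linX] linear_functional_add[OF linY] algebra_simps)
      qed
      have "ok (X # rs) XYs f Z"
        unfolding ok_def
      proof (intro conjI allI impI ballI)
        show "linear_functional r" if "r \<in> set (X # rs)" for r
          using that linX linr by auto
        fix c assume c: "\<forall>r\<in>set (X # rs). r c = 0"
        then have "Y c = 0" by (intro Y0) simp
        then show "?f c = 0" using eq[of c] c by simp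
        fix i assume "Z c" "\<forall>(X, Y)\<in>set XYs. X c = 0 \<and> Y c = 0" "i < k"
        then show "c i = 0" using inj[of c] \<open>Y c = 0\<close> c by simp
      qed
      then show ?thesis using linX by blast
    next
      case False
      have "ok (Y # rs) XYs f Z"
        unfolding ok_def
      proof (intro conjI allI impI ballI)
        show "linear_functional r" if "r \<in> set (Y # rs)" for r
          using that linY linr by auto
        fix c assume c: "\<forall>r\<in>set (Y # rs). r c = 0"
        then show "?f c = 0" using eq[of c] by simp
        fix i assume "Z c" "\<forall>(X, Y)\<in>set XYs. X c = 0 \<and> Y c = 0" "i < k"
        then show "c i = 0" using False c by (metis list.set_intros)
      qed
      then show ?thesis using linY by blast
    qed
    then obtain r where r: "ok (r # rs) XYs f Z" by blast
    show ?case using Cons.IH[OF _ Cons.prems(2) r] Cons.prems(1) XY by auto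
  qed
  note cut = this
  obtain rs where len: "length rs = length XYs" and rs: "ok rs [] f Z"
  proof -
    have "c i = 0" if "Z c" "\<forall>(X, Y)\<in>set XYs. X c = 0 \<and> Y c = 0" "i < k" for c i
      by (rule inj[of c i]) (use that in auto)
    then have "ok [] XYs f Z" using zero unfolding ok_def by auto
    then show ?thesis using that cut[of XYs "[]"] lin translate by auto
  qed
  obtain c where c: "\<And>r. r \<in> set rs \<Longrightarrow> r c = 0" "\<And>i. i \<notin> {..<k} \<Longrightarrow> c i = 0" "\<exists>i. c i \<noteq> 0"
    using common_kernel_nontrivial[of rs "{..<k}"] rs len dim unfolding ok_def by auto
  have "f c = 0" using rs c unfolding ok_def by auto
  moreover have "\<not> Z c"
  proof
    assume "Z c"
    then have "\<forall>i<k. c i = 0" using rs c unfolding ok_def by auto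
    then show False using c by (metis lessThan_iff)
  qed
  ultimately show ?thesis using that by blast
qed

section \<open>Norm forms of quaternion algebras in coordinates\<close>

text \<open>In characteristic 2, the norm of x + y t in the quadratic algebra K = F[t] with t^2 = t
  + \<alpha>.\<close>

definition binary_norm :: "'a::field \<Rightarrow> 'a \<Rightarrow> 'a \<Rightarrow> 'a" where
  "binary_norm \<alpha> x y = x\<^sup>2 + x * y + \<alpha> * y\<^sup>2"

text \<open>The reduced norm of a + b x + c y + d x y in [\<alpha>,\<beta>).\<close>

definition quaternion_norm :: "'a::field \<Rightarrow> 'a \<Rightarrow> 'a \<Rightarrow> 'a \<Rightarrow> 'a \<Rightarrow> 'a \<Rightarrow> 'a" where
  "quaternion_norm \<alpha> \<beta> a b c d = binary_norm \<alpha> a b + \<beta> * binary_norm \<alpha> c d"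

definition row :: "(nat \<Rightarrow> nat \<Rightarrow> 'a::field) \<Rightarrow> nat \<Rightarrow> 'a \<Rightarrow> 'a \<Rightarrow> 'a \<Rightarrow> 'a \<Rightarrow> 'a" where
  "row p i a b c d = p i 0 * a + p i 1 * b + p i 2 * c + p i 3 * d"

text \<open>An isometry by its matrix coefficients, with injectivity instead of an inverse: enough
  to transport a totally isotropic space without losing dimension.\<close>

definition norm_embedding :: "(nat \<Rightarrow> nat \<Rightarrow> 'a::field) \<Rightarrow> 'a \<Rightarrow> 'a \<Rightarrow> 'a \<Rightarrow> 'a \<Rightarrow> bool" where
  "norm_embedding p \<alpha> \<beta> \<alpha>' \<beta>' \<longleftrightarrow>
     (\<forall>a b c d. quaternion_norm \<alpha>' \<beta>' (row p 0 a b c d) (row p 1 a b c d) (row p 2 a b c d)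
        (row p 3 a b c d) = quaternion_norm \<alpha> \<beta> a b c d) \<and>
     (\<forall>a b c d. row p 0 a b c d = 0 \<and> row p 1 a b c d = 0 \<and> row p 2 a b c d = 0 \<and>
        row p 3 a b c d = 0 \<longrightarrow> a = 0 \<and> b = 0 \<and> c = 0 \<and> d = 0)"

lemma norm_embeddingD:
  assumes "norm_embedding p \<alpha> \<beta> \<alpha>' \<beta>'"
  shows "quaternion_norm \<alpha>' \<beta>' (row p 0 a b c d) (row p 1 a b c d) (row p 2 a b c d)
      (row p 3 a b c d) = quaternion_norm \<alpha> \<beta> a b c d"
    and "row p 0 a b c d = 0 \<Longrightarrow> row p 1 a b c d = 0 \<Longrightarrow> row p 2 a b c d = 0 \<Longrightarrow>
      row p 3 a b c d = 0 \<Longrightarrow> a = 0 \<and> b = 0 \<and> c = 0 \<and> d = 0"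
  using assms unfolding norm_embedding_def by blast+

text \<open>One embedding in each direction, so that reversing an isometry needs no matrix
  inversion.\<close>

definition norm_equiv :: "'a::field \<Rightarrow> 'a \<Rightarrow> 'a \<Rightarrow> 'a \<Rightarrow> bool" where
  "norm_equiv \<alpha> \<beta> \<alpha>' \<beta>' \<longleftrightarrow>
     (\<exists>p. norm_embedding p \<alpha> \<beta> \<alpha>' \<beta>') \<and> (\<exists>p. norm_embedding p \<alpha>' \<beta>' \<alpha> \<beta>)"

definition norms_linked :: "('a::field \<times> 'a) set \<Rightarrow> bool" where
  "norms_linked S \<longleftrightarrow>
     (\<exists>g. \<forall>(\<alpha>, \<beta>)\<in>S. \<exists>e. e \<noteq> 0 \<and> norm_equiv \<alpha> \<beta> g e) \<or>
     (\<exists>e. e \<noteq> 0 \<and> (\<forall>(\<alpha>, \<beta>)\<in>S. \<exists>g. norm_equiv \<alpha> \<beta> g e))"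

text \<open>The form is \<open>b\<^sub>1 [1,a\<^sub>1] \<bottom> b\<^sub>2 [1,a\<^sub>2] \<bottom> \<langle>1\<rangle>\<close>.\<close>

definition isotropic5 :: "'a::field \<Rightarrow> 'a \<Rightarrow> 'a \<Rightarrow> 'a \<Rightarrow> bool" where
  "isotropic5 a\<^sub>1 b\<^sub>1 a\<^sub>2 b\<^sub>2 \<longleftrightarrow>
     (\<exists>x\<^sub>1 y\<^sub>1 x\<^sub>2 y\<^sub>2 t. (x\<^sub>1 \<noteq> 0 \<or> y\<^sub>1 \<noteq> 0 \<or> x\<^sub>2 \<noteq> 0 \<or> y\<^sub>2 \<noteq> 0 \<or> t \<noteq> 0) \<and>
        b\<^sub>1 * binary_norm a\<^sub>1 x\<^sub>1 y\<^sub>1 + b\<^sub>2 * binary_norm a\<^sub>2 x\<^sub>2 y\<^sub>2 + t\<^sup>2 = 0)"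

definition pfister3_isotropic :: "'a::field \<Rightarrow> 'a \<Rightarrow> 'a \<Rightarrow> bool" where
  "pfister3_isotropic \<alpha> \<beta> \<gamma> \<longleftrightarrow>
     (\<exists>x\<^sub>0 x\<^sub>1 x\<^sub>2 x\<^sub>3 y\<^sub>0 y\<^sub>1 y\<^sub>2 y\<^sub>3.
        (x\<^sub>0 \<noteq> 0 \<or> x\<^sub>1 \<noteq> 0 \<or> x\<^sub>2 \<noteq> 0 \<or> x\<^sub>3 \<noteq> 0 \<or> y\<^sub>0 \<noteq> 0 \<or> y\<^sub>1 \<noteq> 0 \<or> y\<^sub>2 \<noteq> 0 \<or> y\<^sub>3 \<noteq> 0) \<and>
        quaternion_norm \<alpha> \<beta> x\<^sub>0 x\<^sub>1 x\<^sub>2 x\<^sub>3 + \<gamma> * quaternion_norm \<alpha> \<beta> y\<^sub>0 y\<^sub>1 y\<^sub>2 y\<^sub>3 = 0)"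

lemma binary_norm_0 [simp]: "binary_norm \<alpha> 0 0 = 0"
  and binary_norm_x_0 [simp]: "binary_norm \<alpha> x 0 = x\<^sup>2"
  by (simp_all add: binary_norm_def)

lemma binary_norm_scale: "binary_norm \<alpha> (k * x) (k * y) = k\<^sup>2 * binary_norm \<alpha> x y"
  by (simp add: binary_norm_def algebra_simps power2_eq_square)

lemma quaternion_norm_scale:
  "quaternion_norm \<alpha> \<beta> (k * a) (k * b) (k * c) (k * d) = k\<^sup>2 * quaternion_norm \<alpha> \<beta> a b c d"
  by (simp add: quaternion_norm_def binary_norm_scale distrib_left mult.left_commute)

lemma row_add: "row p i (a + a') (b + b') (c + c') (d + d') = row p i a b c d + row p i a' b' c' d'"
  by (simp add: row_def algebra_simps)

lemma row_scale: "row p i (k * a) (k * b) (k * c) (k * d) = k * row p i a b c d"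
  by (simp add: row_def algebra_simps)

lemma linear_functional_row:
  assumes "linear_functional r\<^sub>0" "linear_functional r\<^sub>1" "linear_functional r\<^sub>2" "linear_functional r\<^sub>3"
  shows "linear_functional (\<lambda>c. row p i (r\<^sub>0 c) (r\<^sub>1 c) (r\<^sub>2 c) (r\<^sub>3 c))"
  using assms by (simp add: linear_functional_def row_add row_scale)

lemma linear_functional_plus:
  "linear_functional r \<Longrightarrow> linear_functional s \<Longrightarrow> linear_functional (\<lambda>c. r c + s c)"
  by (simp add: linear_functional_def algebra_simps)

lemma linear_functional_times:
  "linear_functional r \<Longrightarrow> linear_functional (\<lambda>c. k * r c)"
  by (simp add: linear_functional_def algebra_simps)

lemma linear_functional_coord: "linear_functional (\<lambda>c. c i)"
  by (simp add: linear_functional_def)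

lemmas linear_functional_intros =
  linear_functional_row linear_functional_plus linear_functional_times linear_functional_coord

section \<open>Arithmetic in characteristic 2 and universality of norm forms\<close>

locale char2_field =
  fixes F :: "'a::field itself"
  assumes CHAR2: "CHAR('a) = 2"
begin

lemma char2_add: "x + x = (0::'a)" "x + (x + y) = (y::'a)"
  using CHAR_2_add_self[OF CHAR2, of x] by (simp_all add: add.assoc [symmetric])

lemma char2_neg: "- x = (x::'a)"
  using char2_add(1)[of x] by (simp add: add_eq_0_iff)

lemma char2_diff: "x - y = x + (y::'a)"
  using char2_neg[of y] by simp

lemma char2_eq_iff: "x + y = 0 \<longleftrightarrow> x = (y::'a)"
  by (metis add_eq_0_iff char2_neg)

text \<open>Proves polynomial identities in characteristic 2: ordered rewriting brings equal
  monomials together, where \<open>char2_add\<close> cancels them.\<close>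

lemmas char2_ring = distrib_left distrib_right mult.assoc mult.commute mult.left_commute
  add.assoc add.commute add.left_commute char2_add add_0_left add_0_right power2_eq_square

lemma char2_square_add: "(x + y)\<^sup>2 = x\<^sup>2 + (y::'a)\<^sup>2"
  by (simp only: char2_ring)

text \<open>Multiplicativity of the reduced norm: the arguments on the right are the coordinates of
  the product in \<open>quaternion_model\<close>.\<close>

lemma quaternion_norm_mult:
  "quaternion_norm \<alpha> \<beta> a b c d * quaternion_norm \<alpha> \<beta> a' b' c' d' =
   quaternion_norm \<alpha> \<beta>
     (a * a' + \<alpha> * b * b' + \<beta> * (c * (c' + d') + \<alpha> * d * d'))
     (a * b' + b * a' + b * b' + \<beta> * (c * d' + d * c'))
     (a * c' + \<alpha> * b * d' + c * (a' + b') + \<alpha> * d * b')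
     (a * d' + b * c' + b * d' + c * b' + d * (a'::'a))"
  unfolding quaternion_norm_def binary_norm_def
  by (simp only: char2_square_add power_mult_distrib) (simp only: char2_ring)

text \<open>Multiplicativity of the norm of K: the arguments on the right are the coordinates of (a
  + b t)(a' + b' t).\<close>

lemma binary_norm_mult:
  "binary_norm \<alpha> a b * binary_norm \<alpha> a' b' =
   binary_norm \<alpha> (a * a' + \<alpha> * b * b') (a * b' + b * a' + b * (b'::'a))"
  by (simp only: binary_norm_def char2_ring)

lemma binary_norm_add:
  "binary_norm \<alpha> (x + x') (y + y') =
   binary_norm \<alpha> x y + binary_norm \<alpha> x' y' + (x * y' + x' * (y::'a))"
  by (simp only: binary_norm_def char2_ring)

text \<open>Take a vector u whose polar product with the isotropic vector x is 1. The form at k x +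
  u is k plus its value at u, and k is free.\<close>

lemma isotropic_imp_universal:
  assumes "b\<^sub>1 * binary_norm a x\<^sub>1 y\<^sub>1 + b\<^sub>2 * binary_norm a x\<^sub>2 y\<^sub>2 = 0"
    and nz: "x\<^sub>1 \<noteq> 0 \<or> y\<^sub>1 \<noteq> 0 \<or> x\<^sub>2 \<noteq> 0 \<or> y\<^sub>2 \<noteq> 0" and b: "b\<^sub>1 \<noteq> 0" "b\<^sub>2 \<noteq> 0"
  obtains x\<^sub>1' y\<^sub>1' x\<^sub>2' y\<^sub>2' where "b\<^sub>1 * binary_norm a x\<^sub>1' y\<^sub>1' + b\<^sub>2 * binary_norm a x\<^sub>2' y\<^sub>2' = (r::'a)"
proof -
  define h where "h x y x' y' = b\<^sub>1 * binary_norm a x y + b\<^sub>2 * binary_norm a x' y'" for x y x' y'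
  \<comment> \<open>The left side is the polar form; a nonzero coordinate of the isotropic vector is
    paired with its partner coordinate.\<close>
  have "\<exists>u\<^sub>1 v\<^sub>1 u\<^sub>2 v\<^sub>2. b\<^sub>1 * (x\<^sub>1 * v\<^sub>1 + u\<^sub>1 * y\<^sub>1) + b\<^sub>2 * (x\<^sub>2 * v\<^sub>2 + u\<^sub>2 * y\<^sub>2) = 1"
  proof -
    consider "x\<^sub>1 \<noteq> 0" | "y\<^sub>1 \<noteq> 0" | "x\<^sub>2 \<noteq> 0" | "y\<^sub>2 \<noteq> 0" using nz by blast
    then show ?thesis
    proof cases
      case 1
      then show ?thesis using b
        by (intro exI[of _ 0] exI[of _ "1 / (b\<^sub>1 * x\<^sub>1)"] exI[of _ "0::'a"]) simp
    next
      case 2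
      then show ?thesis using b
        by (intro exI[of _ "1 / (b\<^sub>1 * y\<^sub>1)"] exI[of _ "0::'a"]) simp
    next
      case 3
      then show ?thesis using b
        by (intro exI[of _ 0] exI[of _ "0::'a"] exI[of _ "0::'a"] exI[of _ "1 / (b\<^sub>2 * x\<^sub>2)"]) simp
    next
      case 4
      then show ?thesis using b
        by (intro exI[of _ 0] exI[of _ "0::'a"] exI[of _ "1 / (b\<^sub>2 * y\<^sub>2)"] exI[of _ "0::'a"]) simp
    qed
  qed
  then obtain u\<^sub>1 v\<^sub>1 u\<^sub>2 v\<^sub>2
    where uv: "b\<^sub>1 * (x\<^sub>1 * v\<^sub>1 + u\<^sub>1 * y\<^sub>1) + b\<^sub>2 * (x\<^sub>2 * v\<^sub>2 + u\<^sub>2 * y\<^sub>2) = 1" by blast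
  define k where "k = r + h u\<^sub>1 v\<^sub>1 u\<^sub>2 v\<^sub>2"
  have "h (k * x\<^sub>1 + u\<^sub>1) (k * y\<^sub>1 + v\<^sub>1) (k * x\<^sub>2 + u\<^sub>2) (k * y\<^sub>2 + v\<^sub>2) =
      k\<^sup>2 * h x\<^sub>1 y\<^sub>1 x\<^sub>2 y\<^sub>2 + h u\<^sub>1 v\<^sub>1 u\<^sub>2 v\<^sub>2
        + k * (b\<^sub>1 * (x\<^sub>1 * v\<^sub>1 + u\<^sub>1 * y\<^sub>1) + b\<^sub>2 * (x\<^sub>2 * v\<^sub>2 + u\<^sub>2 * y\<^sub>2))"
    by (simp only: h_def binary_norm_def char2_ring)
  also have "\<dots> = r"
  proof -
    have "h x\<^sub>1 y\<^sub>1 x\<^sub>2 y\<^sub>2 = 0" using assms(1) by (simp add: h_def)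
    moreover have "h u\<^sub>1 v\<^sub>1 u\<^sub>2 v\<^sub>2 + k = r" by (simp only: k_def char2_ring)
    ultimately show ?thesis using uv by simp
  qed
  finally show ?thesis using that by (simp add: h_def)
qed

text \<open>An isotropic vector gives N(x) = r N(y). If N(y) = 0, then N itself is isotropic, hence
  universal. Otherwise r = N(x) N(y) / N(y)^2, which is a norm by multiplicativity.\<close>

lemma quaternion_norm_universal:
  assumes iso: "\<And>\<gamma>. \<gamma> \<noteq> 0 \<Longrightarrow> pfister3_isotropic \<alpha> \<beta> \<gamma>" and \<beta>: "\<beta> \<noteq> 0" and r: "(r::'a) \<noteq> 0"
  obtains a b c d where "quaternion_norm \<alpha> \<beta> a b c d = r"
proof -
  note rep = that
  obtain x\<^sub>0 x\<^sub>1 x\<^sub>2 x\<^sub>3 y\<^sub>0 y\<^sub>1 y\<^sub>2 y\<^sub>3 where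
    nz: "x\<^sub>0 \<noteq> 0 \<or> x\<^sub>1 \<noteq> 0 \<or> x\<^sub>2 \<noteq> 0 \<or> x\<^sub>3 \<noteq> 0 \<or> y\<^sub>0 \<noteq> 0 \<or> y\<^sub>1 \<noteq> 0 \<or> y\<^sub>2 \<noteq> 0 \<or> y\<^sub>3 \<noteq> 0" and
    eq: "quaternion_norm \<alpha> \<beta> x\<^sub>0 x\<^sub>1 x\<^sub>2 x\<^sub>3 + r * quaternion_norm \<alpha> \<beta> y\<^sub>0 y\<^sub>1 y\<^sub>2 y\<^sub>3 = 0"
    using iso[OF r] unfolding pfister3_isotropic_def by blast
  have univ: thesis if h: "quaternion_norm \<alpha> \<beta> a b c d = 0" and nz': "a \<noteq> 0 \<or> b \<noteq> 0 \<or> c \<noteq> 0 \<or> d \<noteq> 0" for a b c d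
  proof -
    have "1 * binary_norm \<alpha> a b + \<beta> * binary_norm \<alpha> c d = 0"
      using h by (simp add: quaternion_norm_def)
    then obtain a' b' c' d' where "1 * binary_norm \<alpha> a' b' + \<beta> * binary_norm \<alpha> c' d' = r"
      by (rule isotropic_imp_universal[OF _ nz' one_neq_zero \<beta>])
    then show thesis by (intro rep) (simp add: quaternion_norm_def)
  qed
  show thesis
  proof (cases "quaternion_norm \<alpha> \<beta> y\<^sub>0 y\<^sub>1 y\<^sub>2 y\<^sub>3 = 0")
    case True
    then show ?thesis using univ nz eq by auto
  next
    case False
    define Y where "Y = quaternion_norm \<alpha> \<beta> y\<^sub>0 y\<^sub>1 y\<^sub>2 y\<^sub>3"
    obtain a b c d where "quaternion_norm \<alpha> \<beta> x\<^sub>0 x\<^sub>1 x\<^sub>2 x\<^sub>3 * Y = quaternion_norm \<alpha> \<beta> a b c d"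
      unfolding Y_def using quaternion_norm_mult by blast
    moreover have "quaternion_norm \<alpha> \<beta> x\<^sub>0 x\<^sub>1 x\<^sub>2 x\<^sub>3 = r * Y"
      using eq by (simp add: Y_def char2_eq_iff)
    ultimately have "quaternion_norm \<alpha> \<beta> ((1/Y) * a) ((1/Y) * b) ((1/Y) * c) ((1/Y) * d) = r"
      using False by (simp only: quaternion_norm_scale) (simp add: Y_def power2_eq_square field_simps)
    then show ?thesis using that by blast
  qed
qed

lemma isotropic5_represents_1:
  assumes "isotropic5 g e\<^sub>1 g (e\<^sub>2::'a)" and e: "e\<^sub>1 \<noteq> 0" "e\<^sub>2 \<noteq> 0"
  obtains x\<^sub>1 y\<^sub>1 x\<^sub>2 y\<^sub>2 where "e\<^sub>1 * binary_norm g x\<^sub>1 y\<^sub>1 + e\<^sub>2 * binary_norm g x\<^sub>2 y\<^sub>2 = 1"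
proof -
  obtain x\<^sub>1 y\<^sub>1 x\<^sub>2 y\<^sub>2 t where nz: "x\<^sub>1 \<noteq> 0 \<or> y\<^sub>1 \<noteq> 0 \<or> x\<^sub>2 \<noteq> 0 \<or> y\<^sub>2 \<noteq> 0 \<or> t \<noteq> 0" and
    eq: "e\<^sub>1 * binary_norm g x\<^sub>1 y\<^sub>1 + e\<^sub>2 * binary_norm g x\<^sub>2 y\<^sub>2 + t\<^sup>2 = 0"
    using assms(1) unfolding isotropic5_def by blast
  show thesis
  proof (cases "t = 0")
    case True
    then have "e\<^sub>1 * binary_norm g x\<^sub>1 y\<^sub>1 + e\<^sub>2 * binary_norm g x\<^sub>2 y\<^sub>2 = 0"
      and "x\<^sub>1 \<noteq> 0 \<or> y\<^sub>1 \<noteq> 0 \<or> x\<^sub>2 \<noteq> 0 \<or> y\<^sub>2 \<noteq> 0"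
      using eq nz by simp_all
    then show ?thesis
      by (rule isotropic_imp_universal[OF _ _ e]) (rule that)
  next
    case False
    have "e\<^sub>1 * binary_norm g ((1/t) * x\<^sub>1) ((1/t) * y\<^sub>1) + e\<^sub>2 * binary_norm g ((1/t) * x\<^sub>2) ((1/t) * y\<^sub>2) =
      (e\<^sub>1 * binary_norm g x\<^sub>1 y\<^sub>1 + e\<^sub>2 * binary_norm g x\<^sub>2 y\<^sub>2) / t\<^sup>2"
      by (simp only: binary_norm_scale) (simp add: power_divide add_divide_distrib)
    also have "\<dots> = 1" using eq False by (simp add: char2_eq_iff)
    finally show ?thesis using that by blast
  qed
qed

text \<open>A 3-dimensional totally isotropic space in the two norm forms plus <1> suffices. Since
  [1,a] takes the value x^2 + (x + a y) y, each of the two summands [1,a] splits into a square and a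
  product; the two squares merge with that of \<open>w\<close>, and only two hyperbolic planes
  remain.\<close>

lemma isotropic5I:
  fixes p q :: "nat \<Rightarrow> nat \<Rightarrow> 'a" and u v :: "nat \<Rightarrow> (nat \<Rightarrow> 'a) \<Rightarrow> 'a"
  assumes emb: "norm_embedding p a\<^sub>1' b\<^sub>1' a\<^sub>1 b\<^sub>1" "norm_embedding q a\<^sub>2' b\<^sub>2' a\<^sub>2 b\<^sub>2"
    and lin: "\<And>i. i < 4 \<Longrightarrow> linear_functional (u i)" "\<And>i. i < 4 \<Longrightarrow> linear_functional (v i)"
      "linear_functional w"
    and zero: "\<And>c. quaternion_norm a\<^sub>1' b\<^sub>1' (u 0 c) (u 1 c) (u 2 c) (u 3 c)
        + quaternion_norm a\<^sub>2' b\<^sub>2' (v 0 c) (v 1 c) (v 2 c) (v 3 c) + (w c)\<^sup>2 = 0"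
    and inj: "\<And>c. u 0 c = 0 \<Longrightarrow> u 1 c = 0 \<Longrightarrow> u 2 c = 0 \<Longrightarrow> u 3 c = 0 \<Longrightarrow>
        v 0 c = 0 \<Longrightarrow> v 1 c = 0 \<Longrightarrow> v 2 c = 0 \<Longrightarrow> v 3 c = 0 \<Longrightarrow> w c = 0 \<Longrightarrow>
        c 0 = 0 \<and> c 1 = 0 \<and> c 2 = 0"
  shows "isotropic5 a\<^sub>1 b\<^sub>1 a\<^sub>2 b\<^sub>2"
proof -
  define P where "P i c = row p i (u 0 c) (u 1 c) (u 2 c) (u 3 c)" for i c
  define Q where "Q i c = row q i (v 0 c) (v 1 c) (v 2 c) (v 3 c)" for i c
  have P: "linear_functional (P i)" and Q: "linear_functional (Q i)" for i
    unfolding P_def Q_def by (intro linear_functional_row lin; simp)+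
  have zero': "quaternion_norm a\<^sub>1 b\<^sub>1 (P 0 c) (P 1 c) (P 2 c) (P 3 c)
      + quaternion_norm a\<^sub>2 b\<^sub>2 (Q 0 c) (Q 1 c) (Q 2 c) (Q 3 c) + (w c)\<^sup>2 = 0" for c
    by (simp only: P_def Q_def norm_embeddingD(1)[OF emb(1)] norm_embeddingD(1)[OF emb(2)] zero)
  have inj': "c 0 = 0 \<and> c 1 = 0 \<and> c 2 = 0"
    if "P 0 c = 0" "P 1 c = 0" "P 2 c = 0" "P 3 c = 0" "Q 0 c = 0" "Q 1 c = 0" "Q 2 c = 0" "Q 3 c = 0"
      "w c = 0" for c
    using that norm_embeddingD(2)[OF emb(1), of "u 0 c" "u 1 c" "u 2 c" "u 3 c"]
      norm_embeddingD(2)[OF emb(2), of "v 0 c" "v 1 c" "v 2 c" "v 3 c"]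
    unfolding P_def Q_def by (intro inj) blast+
  let ?f = "\<lambda>c. b\<^sub>1 * binary_norm a\<^sub>1 (P 2 c) (P 3 c) + b\<^sub>2 * binary_norm a\<^sub>2 (Q 2 c) (Q 3 c)
      + (P 0 c + Q 0 c + w c)\<^sup>2"
  let ?Z = "\<lambda>c. P 2 c = 0 \<and> P 3 c = 0 \<and> Q 2 c = 0 \<and> Q 3 c = 0 \<and> P 0 c + Q 0 c + w c = 0"
  obtain c where "?f c = 0" "\<not> ?Z c"
  proof (rule isotropic_if_large_isotropic_space[of
        "[(\<lambda>c. P 0 c + a\<^sub>1 * P 1 c, P 1), (\<lambda>c. Q 0 c + a\<^sub>2 * Q 1 c, Q 1)]" ?f ?Z 3])
    show "?f c + (\<Sum>(X, Y)\<leftarrow>[(\<lambda>c. P 0 c + a\<^sub>1 * P 1 c, P 1), (\<lambda>c. Q 0 c + a\<^sub>2 * Q 1 c, Q 1)]. X c * Y c) = 0" for c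
    proof -
      have "?f c + (\<Sum>(X, Y)\<leftarrow>[(\<lambda>c. P 0 c + a\<^sub>1 * P 1 c, P 1), (\<lambda>c. Q 0 c + a\<^sub>2 * Q 1 c, Q 1)]. X c * Y c)
        = quaternion_norm a\<^sub>1 b\<^sub>1 (P 0 c) (P 1 c) (P 2 c) (P 3 c)
          + quaternion_norm a\<^sub>2 b\<^sub>2 (Q 0 c) (Q 1 c) (Q 2 c) (Q 3 c) + (w c)\<^sup>2"
        by (simp only: quaternion_norm_def binary_norm_def list.map sum_list.Cons sum_list.Nil split char2_ring)
      then show ?thesis using zero' by simp
    qed
    show "?f (\<lambda>i. c i + d i) = ?f d" if "?Z c" for c d
    proof -
      have "P 0 (\<lambda>i. c i + d i) + Q 0 (\<lambda>i. c i + d i) + w (\<lambda>i. c i + d i) = P 0 d + Q 0 d + w d"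
      proof -
        have "P 0 c + Q 0 c + w c + (P 0 d + Q 0 d + w d) = P 0 d + Q 0 d + w d"
          using that by simp
        then show ?thesis
          by (simp only: linear_functional_add[OF P] linear_functional_add[OF Q]
              linear_functional_add[OF lin(3)] add.assoc add.left_commute add.commute)
      qed
      moreover have "P 2 (\<lambda>i. c i + d i) = P 2 d" "P 3 (\<lambda>i. c i + d i) = P 3 d"
        "Q 2 (\<lambda>i. c i + d i) = Q 2 d" "Q 3 (\<lambda>i. c i + d i) = Q 3 d"
        using that by (simp_all add: linear_functional_add[OF P] linear_functional_add[OF Q])
      ultimately show ?thesis by (simp only:)
    qed
    show "c i = 0" if Z: "?Z c" and XY: "\<And>X Y. (X, Y) \<in> set [(\<lambda>c. P 0 c + a\<^sub>1 * P 1 c, P 1),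
        (\<lambda>c. Q 0 c + a\<^sub>2 * Q 1 c, Q 1)] \<Longrightarrow> X c = 0 \<and> Y c = 0" and i: "i < 3" for c i
    proof -
      have "P 0 c + a\<^sub>1 * P 1 c = 0 \<and> P 1 c = 0" "Q 0 c + a\<^sub>2 * Q 1 c = 0 \<and> Q 1 c = 0"
        by (rule XY; simp)+
      then have "c 0 = 0 \<and> c 1 = 0 \<and> c 2 = 0" using Z by (intro inj') auto
      moreover have "i = 0 \<or> i = 1 \<or> i = 2" using i by auto
      ultimately show ?thesis by auto
    qed
  qed (use P Q in \<open>auto intro!: linear_functional_intros\<close>)
  then show ?thesis unfolding isotropic5_def by blast
qed

section \<open>Linked pairs\<close>

lemma isotropic5_if_norms_linked:
  assumes iso: "\<And>\<alpha> \<beta> \<gamma>. \<beta> \<noteq> 0 \<Longrightarrow> \<gamma> \<noteq> 0 \<Longrightarrow> pfister3_isotropic \<alpha> \<beta> (\<gamma>::'a)"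
    and linked: "norms_linked {(a\<^sub>1, b\<^sub>1), (a\<^sub>2, b\<^sub>2::'a)}"
  shows "isotropic5 a\<^sub>1 b\<^sub>1 a\<^sub>2 b\<^sub>2"
  using linked unfolding norms_linked_def
proof
  assume "\<exists>g. \<forall>(\<alpha>, \<beta>)\<in>{(a\<^sub>1, b\<^sub>1), (a\<^sub>2, b\<^sub>2)}. \<exists>e. e \<noteq> 0 \<and> norm_equiv \<alpha> \<beta> g e"
  then obtain g e\<^sub>1 e\<^sub>2 p q where e: "e\<^sub>1 \<noteq> 0" "e\<^sub>2 \<noteq> 0"
    and p: "norm_embedding p g e\<^sub>1 a\<^sub>1 b\<^sub>1" and q: "norm_embedding q g e\<^sub>2 a\<^sub>2 b\<^sub>2"
    unfolding norm_equiv_def by auto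
  \<comment> \<open>Universality of <1, \<open>e\<^sub>2 / e\<^sub>1\<close>> * [1,g], scaled by
    \<open>e\<^sub>1\<close>, makes \<open>e\<^sub>1\<close> [1,g] + \<open>e\<^sub>2\<close> [1,g]
    represent 1.\<close>
  obtain r\<^sub>0 r\<^sub>1 r\<^sub>2 r\<^sub>3 where "quaternion_norm g (e\<^sub>2 / e\<^sub>1) r\<^sub>0 r\<^sub>1 r\<^sub>2 r\<^sub>3 = 1 / e\<^sub>1"
    by (rule quaternion_norm_universal[of g "e\<^sub>2 / e\<^sub>1" "1 / e\<^sub>1"]) (use iso e in auto)
  then have r: "e\<^sub>1 * binary_norm g r\<^sub>0 r\<^sub>1 + e\<^sub>2 * binary_norm g r\<^sub>2 r\<^sub>3 = 1"
    using e by (simp add: quaternion_norm_def field_simps)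
  show ?thesis
  \<comment> \<open>Two parameters enter both copies of [1,g] equally and cancel. The third scales
    the vector of value 1 against <1>.\<close>
  proof (rule isotropic5I[OF p q, where u = "\<lambda>i c. [c 0, c 1, c 2 * r\<^sub>0, c 2 * r\<^sub>1] ! i"
        and v = "\<lambda>i c. [c 0, c 1, c 2 * r\<^sub>2, c 2 * r\<^sub>3] ! i" and w = "\<lambda>c. c 2"])
    fix c :: "nat \<Rightarrow> 'a"
    have "quaternion_norm g e\<^sub>1 (c 0) (c 1) (c 2 * r\<^sub>0) (c 2 * r\<^sub>1)
        + quaternion_norm g e\<^sub>2 (c 0) (c 1) (c 2 * r\<^sub>2) (c 2 * r\<^sub>3) + (c 2)\<^sup>2
      = (c 2)\<^sup>2 * (e\<^sub>1 * binary_norm g r\<^sub>0 r\<^sub>1 + e\<^sub>2 * binary_norm g r\<^sub>2 r\<^sub>3) + (c 2)\<^sup>2"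
      by (simp only: quaternion_norm_def binary_norm_scale) (simp only: char2_ring)
    also have "\<dots> = 0" by (simp add: r char2_add)
    finally show "quaternion_norm g e\<^sub>1 ([c 0, c 1, c 2 * r\<^sub>0, c 2 * r\<^sub>1] ! 0)
        ([c 0, c 1, c 2 * r\<^sub>0, c 2 * r\<^sub>1] ! 1) ([c 0, c 1, c 2 * r\<^sub>0, c 2 * r\<^sub>1] ! 2)
        ([c 0, c 1, c 2 * r\<^sub>0, c 2 * r\<^sub>1] ! 3)
      + quaternion_norm g e\<^sub>2 ([c 0, c 1, c 2 * r\<^sub>2, c 2 * r\<^sub>3] ! 0)
        ([c 0, c 1, c 2 * r\<^sub>2, c 2 * r\<^sub>3] ! 1) ([c 0, c 1, c 2 * r\<^sub>2, c 2 * r\<^sub>3] ! 2)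
        ([c 0, c 1, c 2 * r\<^sub>2, c 2 * r\<^sub>3] ! 3) + (c 2)\<^sup>2 = 0"
      by (simp add: numeral_2_eq_2 numeral_3_eq_3)
  qed (auto simp: linear_functional_def less_Suc_eq numeral_nat algebra_simps)
next
  assume "\<exists>e. e \<noteq> 0 \<and> (\<forall>(\<alpha>, \<beta>)\<in>{(a\<^sub>1, b\<^sub>1), (a\<^sub>2, b\<^sub>2)}. \<exists>g. norm_equiv \<alpha> \<beta> g e)"
  then obtain e g\<^sub>1 g\<^sub>2 p q where p: "norm_embedding p g\<^sub>1 e a\<^sub>1 b\<^sub>1" and q: "norm_embedding q g\<^sub>2 e a\<^sub>2 b\<^sub>2"
    unfolding norm_equiv_def by auto
  show ?thesis
    \<comment> \<open>On the span of 1 and y both norms are a^2 + e b^2, which is additive, so equal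
      \<open>e\<close>-parts cancel and the remaining squares combine with that of
      \<open>w\<close>.\<close>
    by (rule isotropic5I[OF p q, where u = "\<lambda>i c. [c 0, 0, c 1, 0] ! i"
        and v = "\<lambda>i c. [c 2, 0, c 1, 0] ! i" and w = "\<lambda>c. c 0 + c 2"])
      (auto simp: linear_functional_def less_Suc_eq numeral_nat algebra_simps
        quaternion_norm_def char2_square_add char2_add)
qed

text \<open>
  If the pure elements \<open>(x\<^sub>1, y\<^sub>1)\<close> and \<open>(x\<^sub>2, y\<^sub>2)\<close> of two quaternion algebras have the same square
  \<open>D\<close>, the algebras share an inseparable quadratic extension. If they also share a separable one,
  this constrains their second slots.
\<close>

lemma common_pure_square_imp_represents_1:
  assumes emb: "norm_embedding p a\<^sub>1 b\<^sub>1 g e\<^sub>1" "norm_embedding q a\<^sub>2 b\<^sub>2 g (e\<^sub>2::'a)"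
    and e: "e\<^sub>1 \<noteq> 0" "e\<^sub>2 \<noteq> 0"
    and D: "b\<^sub>1 * binary_norm a\<^sub>1 x\<^sub>1 y\<^sub>1 = D" "b\<^sub>2 * binary_norm a\<^sub>2 x\<^sub>2 y\<^sub>2 = D" "D \<noteq> 0"
  obtains s\<^sub>1 t\<^sub>1 s\<^sub>2 t\<^sub>2 where "e\<^sub>1 * binary_norm g s\<^sub>1 t\<^sub>1 + e\<^sub>2 * binary_norm g s\<^sub>2 t\<^sub>2 = 1"
proof -
  have nz: "x\<^sub>1 \<noteq> 0 \<or> y\<^sub>1 \<noteq> 0" using D by auto
  have "isotropic5 g e\<^sub>1 g e\<^sub>2"
  \<comment> \<open>The spanning vectors are: 1 in both algebras, the two pure elements of common
    square \<open>D\<close>, and 1 in the first algebra together with 1 in <1>.\<close>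
  proof (rule isotropic5I[OF emb, where u = "\<lambda>i c. [c 0 + c 2, 0, c 1 * x\<^sub>1, c 1 * y\<^sub>1] ! i"
        and v = "\<lambda>i c. [c 0, 0, c 1 * x\<^sub>2, c 1 * y\<^sub>2] ! i" and w = "\<lambda>c. c 2"])
    fix c :: "nat \<Rightarrow> 'a"
    have "quaternion_norm a\<^sub>1 b\<^sub>1 (c 0 + c 2) 0 (c 1 * x\<^sub>1) (c 1 * y\<^sub>1)
        + quaternion_norm a\<^sub>2 b\<^sub>2 (c 0) 0 (c 1 * x\<^sub>2) (c 1 * y\<^sub>2) + (c 2)\<^sup>2
      = (c 1)\<^sup>2 * (b\<^sub>1 * binary_norm a\<^sub>1 x\<^sub>1 y\<^sub>1 + b\<^sub>2 * binary_norm a\<^sub>2 x\<^sub>2 y\<^sub>2)"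
      by (simp only: quaternion_norm_def binary_norm_scale binary_norm_x_0) (simp only: char2_ring add_0_right)
    also have "\<dots> = 0" by (simp add: D char2_add)
    finally show "quaternion_norm a\<^sub>1 b\<^sub>1 ([c 0 + c 2, 0, c 1 * x\<^sub>1, c 1 * y\<^sub>1] ! 0)
        ([c 0 + c 2, 0, c 1 * x\<^sub>1, c 1 * y\<^sub>1] ! 1) ([c 0 + c 2, 0, c 1 * x\<^sub>1, c 1 * y\<^sub>1] ! 2)
        ([c 0 + c 2, 0, c 1 * x\<^sub>1, c 1 * y\<^sub>1] ! 3)
      + quaternion_norm a\<^sub>2 b\<^sub>2 ([c 0, 0, c 1 * x\<^sub>2, c 1 * y\<^sub>2] ! 0)
        ([c 0, 0, c 1 * x\<^sub>2, c 1 * y\<^sub>2] ! 1) ([c 0, 0, c 1 * x\<^sub>2, c 1 * y\<^sub>2] ! 2)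
        ([c 0, 0, c 1 * x\<^sub>2, c 1 * y\<^sub>2] ! 3) + (c 2)\<^sup>2 = 0"
      by (simp add: numeral_2_eq_2 numeral_3_eq_3)
  qed (use nz in \<open>auto simp: linear_functional_def less_Suc_eq numeral_nat algebra_simps\<close>)
  then show ?thesis using isotropic5_represents_1 e that by metis
qed

text \<open>The counterpart of \<open>isotropic5I\<close> for three algebras: 13 dimensions are a
  5-dimensional form and four hyperbolic planes, so a totally isotropic space of dimension 5 is
  large enough.\<close>

lemma isotropic5_if_isotropic_space:
  fixes u v z :: "nat \<Rightarrow> (nat \<Rightarrow> 'a) \<Rightarrow> 'a"
  assumes emb: "norm_embedding p \<alpha>\<^sub>1 \<beta>\<^sub>1 f\<^sub>1 A" "norm_embedding q \<alpha>\<^sub>2 \<beta>\<^sub>2 f\<^sub>2 A"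
      "norm_embedding r \<alpha>\<^sub>3 \<beta>\<^sub>3 (f\<^sub>1 + f\<^sub>2) b" and A: "A \<noteq> 0"
    and lin: "\<And>i. i < 4 \<Longrightarrow> linear_functional (u i)" "\<And>i. i < 4 \<Longrightarrow> linear_functional (v i)"
      "\<And>i. i < 4 \<Longrightarrow> linear_functional (z i)" "linear_functional w"
    and zero: "\<And>c. quaternion_norm \<alpha>\<^sub>1 \<beta>\<^sub>1 (u 0 c) (u 1 c) (u 2 c) (u 3 c)
        + quaternion_norm \<alpha>\<^sub>2 \<beta>\<^sub>2 (v 0 c) (v 1 c) (v 2 c) (v 3 c)
        + quaternion_norm \<alpha>\<^sub>3 \<beta>\<^sub>3 (z 0 c) (z 1 c) (z 2 c) (z 3 c) + (w c)\<^sup>2 = 0"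
    and inj: "\<And>c. u 0 c = 0 \<Longrightarrow> u 1 c = 0 \<Longrightarrow> u 2 c = 0 \<Longrightarrow> u 3 c = 0 \<Longrightarrow>
        v 0 c = 0 \<Longrightarrow> v 1 c = 0 \<Longrightarrow> v 2 c = 0 \<Longrightarrow> v 3 c = 0 \<Longrightarrow>
        z 0 c = 0 \<Longrightarrow> z 1 c = 0 \<Longrightarrow> z 2 c = 0 \<Longrightarrow> z 3 c = 0 \<Longrightarrow> w c = 0 \<Longrightarrow>
        c 0 = 0 \<and> c 1 = 0 \<and> c 2 = 0 \<and> c 3 = 0 \<and> c 4 = 0"
  shows "isotropic5 (f\<^sub>1 + f\<^sub>2) A (f\<^sub>1 + f\<^sub>2) b"
proof -
  define P where "P i c = row p i (u 0 c) (u 1 c) (u 2 c) (u 3 c)" for i c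
  define Q where "Q i c = row q i (v 0 c) (v 1 c) (v 2 c) (v 3 c)" for i c
  define R where "R i c = row r i (z 0 c) (z 1 c) (z 2 c) (z 3 c)" for i c
  have P: "linear_functional (P i)" and Q: "linear_functional (Q i)" and R: "linear_functional (R i)" for i
    unfolding P_def Q_def R_def by (intro linear_functional_row lin; simp)+
  note add = linear_functional_add[OF P] linear_functional_add[OF Q] linear_functional_add[OF R]
    linear_functional_add[OF lin(4)]
  have zero': "quaternion_norm f\<^sub>1 A (P 0 c) (P 1 c) (P 2 c) (P 3 c)
      + quaternion_norm f\<^sub>2 A (Q 0 c) (Q 1 c) (Q 2 c) (Q 3 c)
      + quaternion_norm (f\<^sub>1 + f\<^sub>2) b (R 0 c) (R 1 c) (R 2 c) (R 3 c) + (w c)\<^sup>2 = 0" for c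
    by (simp only: P_def Q_def R_def norm_embeddingD(1)[OF emb(1)] norm_embeddingD(1)[OF emb(2)]
        norm_embeddingD(1)[OF emb(3)] zero)
  have inj': "c 0 = 0 \<and> c 1 = 0 \<and> c 2 = 0 \<and> c 3 = 0 \<and> c 4 = 0"
    if "P 0 c = 0" "P 1 c = 0" "P 2 c = 0" "P 3 c = 0" "Q 0 c = 0" "Q 1 c = 0" "Q 2 c = 0" "Q 3 c = 0"
      "R 0 c = 0" "R 1 c = 0" "R 2 c = 0" "R 3 c = 0" "w c = 0" for c
    using that norm_embeddingD(2)[OF emb(1), of "u 0 c" "u 1 c" "u 2 c" "u 3 c"]
      norm_embeddingD(2)[OF emb(2), of "v 0 c" "v 1 c" "v 2 c" "v 3 c"]
      norm_embeddingD(2)[OF emb(3), of "z 0 c" "z 1 c" "z 2 c" "z 3 c"]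
    unfolding P_def Q_def R_def by (intro inj) blast+
  let ?f = "\<lambda>c. A * binary_norm (f\<^sub>1 + f\<^sub>2) (P 2 c + Q 2 c) (P 3 c)
      + b * binary_norm (f\<^sub>1 + f\<^sub>2) (R 2 c) (R 3 c) + (w c)\<^sup>2"
  let ?Z = "\<lambda>c. P 2 c + Q 2 c = 0 \<and> P 3 c = 0 \<and> R 2 c = 0 \<and> R 3 c = 0 \<and> w c = 0"
  \<comment> \<open>The first three planes exhaust the three summands [1,\<open>f\<^sub>1\<close>],
    [1,\<open>f\<^sub>2\<close>], [1,\<open>f\<^sub>1 + f\<^sub>2\<close>]. The fourth comes from A
    [1,\<open>f\<^sub>1\<close>] + A [1,\<open>f\<^sub>2\<close>] = A
    [1,\<open>f\<^sub>1 + f\<^sub>2\<close>] + plane.\<close>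
  let ?XYs = "[(\<lambda>c. P 0 c + Q 0 c + R 0 c, \<lambda>c. P 0 c + Q 0 c + R 0 c + R 1 c),
      (\<lambda>c. P 0 c + f\<^sub>1 * (P 1 c + R 1 c), \<lambda>c. P 1 c + R 1 c),
      (\<lambda>c. Q 0 c + f\<^sub>2 * (Q 1 c + R 1 c), \<lambda>c. Q 1 c + R 1 c),
      (\<lambda>c. A * (Q 2 c + f\<^sub>2 * (P 3 c + Q 3 c)), \<lambda>c. P 3 c + Q 3 c)]"
  obtain c where "?f c = 0" "\<not> ?Z c"
  proof (rule isotropic_if_large_isotropic_space[of ?XYs ?f ?Z 5])
    show "?f c + (\<Sum>(X, Y)\<leftarrow>?XYs. X c * Y c) = 0" for c
    proof -
      have "?f c + (\<Sum>(X, Y)\<leftarrow>?XYs. X c * Y c) = quaternion_norm f\<^sub>1 A (P 0 c) (P 1 c) (P 2 c) (P 3 c)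
        + quaternion_norm f\<^sub>2 A (Q 0 c) (Q 1 c) (Q 2 c) (Q 3 c)
        + quaternion_norm (f\<^sub>1 + f\<^sub>2) b (R 0 c) (R 1 c) (R 2 c) (R 3 c) + (w c)\<^sup>2"
        by (simp only: quaternion_norm_def binary_norm_def list.map sum_list.Cons sum_list.Nil split char2_ring)
      then show ?thesis by (simp only: zero')
    qed
    show "?f (\<lambda>i. c i + d i) = ?f d" if Z: "?Z c" for c d
    proof -
      have "P 2 (\<lambda>i. c i + d i) + Q 2 (\<lambda>i. c i + d i) = P 2 d + Q 2 d"
      proof -
        have "P 2 c + Q 2 c + (P 2 d + Q 2 d) = P 2 d + Q 2 d" using Z by simp
        then show ?thesis by (simp only: add add.assoc add.left_commute add.commute)
      qed
      moreover have "P 3 (\<lambda>i. c i + d i) = P 3 d" "R 2 (\<lambda>i. c i + d i) = R 2 d"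
        "R 3 (\<lambda>i. c i + d i) = R 3 d" "w (\<lambda>i. c i + d i) = w d"
        using Z by (simp_all add: add)
      ultimately show ?thesis by (simp only:)
    qed
    show "c i = 0" if Z: "?Z c" and XY: "\<And>X Y. (X, Y) \<in> set ?XYs \<Longrightarrow> X c = 0 \<and> Y c = 0"
      and i: "i < 5" for c i
    proof -
      have "P 0 c + Q 0 c + R 0 c = 0 \<and> P 0 c + Q 0 c + R 0 c + R 1 c = 0"
        "P 0 c + f\<^sub>1 * (P 1 c + R 1 c) = 0 \<and> P 1 c + R 1 c = 0"
        "Q 0 c + f\<^sub>2 * (Q 1 c + R 1 c) = 0 \<and> Q 1 c + R 1 c = 0"
        "A * (Q 2 c + f\<^sub>2 * (P 3 c + Q 3 c)) = 0 \<and> P 3 c + Q 3 c = 0"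
        by (rule XY; simp)+
      then have "c 0 = 0 \<and> c 1 = 0 \<and> c 2 = 0 \<and> c 3 = 0 \<and> c 4 = 0"
        using Z A by (intro inj') auto
      moreover have "i = 0 \<or> i = 1 \<or> i = 2 \<or> i = 3 \<or> i = 4" using i by auto
      ultimately show ?thesis by auto
    qed
  qed (use P Q R in \<open>auto intro!: linear_functional_intros\<close>)
  then show ?thesis unfolding isotropic5_def by blast
qed

section \<open>Linked triples\<close>

text \<open>Both \<open>e\<^sub>1\<close> and \<open>e\<^sub>2\<close>, times norms from K, are
  norms from [g,e). Hence so is their product, up to a norm from K; moving the \<open>e\<close>-part
  across leaves a norm k from K as represented value, and k can be scaled to 1.\<close>

lemma represents_1_mult:
  assumes aniso: "\<forall>a b c d. quaternion_norm g e a b c d = 0 \<longrightarrow> a = (0::'a)"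
    and e: "e \<noteq> 0" "e\<^sub>1 \<noteq> 0" "e\<^sub>2 \<noteq> 0"
    and 1: "e\<^sub>1 * binary_norm g s\<^sub>1 t\<^sub>1 + e * binary_norm g u\<^sub>1 v\<^sub>1 = 1"
    and 2: "e\<^sub>2 * binary_norm g s\<^sub>2 t\<^sub>2 + e * binary_norm g u\<^sub>2 v\<^sub>2 = 1"
  obtains s t u v where "e\<^sub>1 * e\<^sub>2 * binary_norm g s t + e * binary_norm g u v = 1"
proof -
  \<comment> \<open>The right side is the norm of 1 + (u + v x) y, which is nonzero by
    anisotropy.\<close>
  have nz: "binary_norm g s t \<noteq> 0 \<and> e' * binary_norm g s t = quaternion_norm g e 1 0 u v"
    if "e' * binary_norm g s t + e * binary_norm g u v = 1" for e' s t u v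
  proof -
    have "e' * binary_norm g s t = 1 + e * binary_norm g u v"
      using that by (metis add.assoc add.commute add_0 char2_add(1))
    then have eq: "e' * binary_norm g s t = quaternion_norm g e 1 0 u v"
      by (simp add: quaternion_norm_def)
    then show ?thesis using aniso[rule_format, of 1 0 u v] by auto
  qed
  obtain a b c d where abcd: "quaternion_norm g e 1 0 u\<^sub>1 v\<^sub>1 * quaternion_norm g e 1 0 u\<^sub>2 v\<^sub>2
      = quaternion_norm g e a b c d"
    using quaternion_norm_mult by blast
  obtain m\<^sub>0 m\<^sub>1 where m: "binary_norm g s\<^sub>1 t\<^sub>1 * binary_norm g s\<^sub>2 t\<^sub>2 = binary_norm g m\<^sub>0 m\<^sub>1"
    using binary_norm_mult by blast
  have "binary_norm g m\<^sub>0 m\<^sub>1 \<noteq> 0"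
    using nz[OF 1] nz[OF 2] m[symmetric] by simp
  then have m0: "m\<^sub>0 \<noteq> 0 \<or> m\<^sub>1 \<noteq> 0" by auto
  have "e\<^sub>1 * e\<^sub>2 * binary_norm g m\<^sub>0 m\<^sub>1 = (e\<^sub>1 * binary_norm g s\<^sub>1 t\<^sub>1) * (e\<^sub>2 * binary_norm g s\<^sub>2 t\<^sub>2)"
    by (simp add: m[symmetric] mult_ac)
  also have "\<dots> = binary_norm g a b + e * binary_norm g c d"
    using nz[OF 1] nz[OF 2] abcd by (simp add: quaternion_norm_def)
  finally have k: "e\<^sub>1 * e\<^sub>2 * binary_norm g m\<^sub>0 m\<^sub>1 + e * binary_norm g c d = binary_norm g a b"
    by (simp add: add.assoc char2_add)
  show thesis
  proof (cases "binary_norm g a b = 0")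
    case True
    then have "e\<^sub>1 * e\<^sub>2 * binary_norm g m\<^sub>0 m\<^sub>1 + e * binary_norm g c d = 0" using k by simp
    moreover have "m\<^sub>0 \<noteq> 0 \<or> m\<^sub>1 \<noteq> 0 \<or> c \<noteq> 0 \<or> d \<noteq> 0" using m0 by auto
    ultimately show thesis
      by (rule isotropic_imp_universal[where r = 1]) (use e that in auto)
  next
    case False
    \<comment> \<open>To divide by the norm \<open>?k\<close>, multiply by it, which acts within
      each copy of [1,g], and divide by its square.\<close>
    let ?k = "binary_norm g a b"
    obtain x y where xy: "binary_norm g m\<^sub>0 m\<^sub>1 * ?k = binary_norm g x y"
      using binary_norm_mult by blast
    obtain x' y' where xy': "binary_norm g c d * ?k = binary_norm g x' y'"
      using binary_norm_mult by blast
    have "e\<^sub>1 * e\<^sub>2 * binary_norm g ((1 / ?k) * x) ((1 / ?k) * y)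
        + e * binary_norm g ((1 / ?k) * x') ((1 / ?k) * y')
      = (e\<^sub>1 * e\<^sub>2 * binary_norm g m\<^sub>0 m\<^sub>1 + e * binary_norm g c d) * ?k * (1 / ?k)\<^sup>2"
      by (simp only: binary_norm_scale xy[symmetric] xy'[symmetric]) (simp add: distrib_left distrib_right mult_ac)
    also have "\<dots> = 1" using False by (simp add: k power2_eq_square)
    finally show thesis using that by blast
  qed
qed

text \<open>
  In the quadratic extension \<open>K\<close> with norm form \<open>[1,g]\<close>, the vectors \<open>(u, v)\<close> and
  \<open>(e\<^sub>2 v\<^sup>*, e\<^sub>1 u\<^sup>*)\<close> of \<open>K\<^sup>2\<close>, where \<open>*\<close> is conjugation, are orthogonal for the hermitian form
  \<open>\<langle>e\<^sub>1, e\<^sub>2\<rangle>\<close>. The identity evaluates that form at the sum of their multiples by \<open>k\<close> and by \<open>c x\<close>.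
\<close>

lemma binary_norm_orthogonal_pair:
  "e\<^sub>1 * binary_norm g (k\<^sub>0 * u\<^sub>0 + g * k\<^sub>1 * u\<^sub>1 + c * e\<^sub>2 * (x\<^sub>0 * v\<^sub>0 + x\<^sub>0 * v\<^sub>1 + g * x\<^sub>1 * v\<^sub>1))
      (k\<^sub>0 * u\<^sub>1 + k\<^sub>1 * u\<^sub>0 + k\<^sub>1 * u\<^sub>1 + c * e\<^sub>2 * (x\<^sub>0 * v\<^sub>1 + x\<^sub>1 * v\<^sub>0))
    + e\<^sub>2 * binary_norm g (k\<^sub>0 * v\<^sub>0 + g * k\<^sub>1 * v\<^sub>1 + c * e\<^sub>1 * (x\<^sub>0 * u\<^sub>0 + x\<^sub>0 * u\<^sub>1 + g * x\<^sub>1 * u\<^sub>1))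
      (k\<^sub>0 * v\<^sub>1 + k\<^sub>1 * v\<^sub>0 + k\<^sub>1 * v\<^sub>1 + c * e\<^sub>1 * (x\<^sub>0 * u\<^sub>1 + x\<^sub>1 * u\<^sub>0))
   = (binary_norm g k\<^sub>0 k\<^sub>1 + c\<^sup>2 * (e\<^sub>1 * e\<^sub>2 * binary_norm g x\<^sub>0 x\<^sub>1))
     * (e\<^sub>1 * binary_norm g u\<^sub>0 u\<^sub>1 + e\<^sub>2 * binary_norm g v\<^sub>0 (v\<^sub>1::'a))"
  unfolding binary_norm_def
  by (simp only: char2_square_add power_mult_distrib) (simp only: char2_ring)

text \<open>\<open>c 0\<close>, \<open>c 1\<close> enter the first two algebras equally and cancel.
  With k = (\<open>c 2\<close>, \<open>c 3\<close>), the second halves of these algebras carry the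
  orthogonal pair of \<open>binary_norm_orthogonal_pair\<close>, with total value n(k) +
  \<open>(c 4)\<^sup>2\<close> \<open>e\<^sub>1 e\<^sub>2\<close> n(x). The third algebra cancels
  n(k) by its first half, and \<open>xy\<close> cancels the rest against <1>.\<close>

lemma isotropic5_if_common_quadratic_factor:
  assumes emb: "norm_embedding p g e\<^sub>1 f\<^sub>1 A" "norm_embedding q g e\<^sub>2 f\<^sub>2 A"
      "norm_embedding r g e\<^sub>3 (f\<^sub>1 + f\<^sub>2) b" and A: "A \<noteq> (0::'a)"
    and uv: "e\<^sub>1 * binary_norm g u\<^sub>0 u\<^sub>1 + e\<^sub>2 * binary_norm g v\<^sub>0 v\<^sub>1 = 1"
    and xy: "e\<^sub>1 * e\<^sub>2 * binary_norm g x\<^sub>0 x\<^sub>1 + e\<^sub>3 * binary_norm g y\<^sub>0 y\<^sub>1 = 1"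
  shows "isotropic5 (f\<^sub>1 + f\<^sub>2) A (f\<^sub>1 + f\<^sub>2) b"
proof -
  let ?U\<^sub>0 = "\<lambda>c. c 2 * u\<^sub>0 + g * c 3 * u\<^sub>1 + c 4 * e\<^sub>2 * (x\<^sub>0 * v\<^sub>0 + x\<^sub>0 * v\<^sub>1 + g * x\<^sub>1 * v\<^sub>1)"
  let ?U\<^sub>1 = "\<lambda>c. c 2 * u\<^sub>1 + c 3 * u\<^sub>0 + c 3 * u\<^sub>1 + c 4 * e\<^sub>2 * (x\<^sub>0 * v\<^sub>1 + x\<^sub>1 * v\<^sub>0)"
  let ?V\<^sub>0 = "\<lambda>c. c 2 * v\<^sub>0 + g * c 3 * v\<^sub>1 + c 4 * e\<^sub>1 * (x\<^sub>0 * u\<^sub>0 + x\<^sub>0 * u\<^sub>1 + g * x\<^sub>1 * u\<^sub>1)"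
  let ?V\<^sub>1 = "\<lambda>c. c 2 * v\<^sub>1 + c 3 * v\<^sub>0 + c 3 * v\<^sub>1 + c 4 * e\<^sub>1 * (x\<^sub>0 * u\<^sub>1 + x\<^sub>1 * u\<^sub>0)"
  let ?u = "\<lambda>i c. [c 0, c 1, ?U\<^sub>0 c, ?U\<^sub>1 c] ! i"
  let ?v = "\<lambda>i c. [c 0, c 1, ?V\<^sub>0 c, ?V\<^sub>1 c] ! i"
  let ?z = "\<lambda>i c. [c 2, c 3, c 4 * y\<^sub>0, c 4 * y\<^sub>1] ! i"
  show ?thesis
  proof (rule isotropic5_if_isotropic_space[OF emb A, where u = ?u and v = ?v and z = ?z and w = "\<lambda>c. c 4"])
    fix c :: "nat \<Rightarrow> 'a"
    have "quaternion_norm g e\<^sub>1 (c 0) (c 1) (?U\<^sub>0 c) (?U\<^sub>1 c)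
        + quaternion_norm g e\<^sub>2 (c 0) (c 1) (?V\<^sub>0 c) (?V\<^sub>1 c)
        + quaternion_norm g e\<^sub>3 (c 2) (c 3) (c 4 * y\<^sub>0) (c 4 * y\<^sub>1) + (c 4)\<^sup>2
      = (e\<^sub>1 * binary_norm g (?U\<^sub>0 c) (?U\<^sub>1 c) + e\<^sub>2 * binary_norm g (?V\<^sub>0 c) (?V\<^sub>1 c))
        + binary_norm g (c 2) (c 3) + (c 4)\<^sup>2 * (e\<^sub>3 * binary_norm g y\<^sub>0 y\<^sub>1) + (c 4)\<^sup>2"
      unfolding quaternion_norm_def binary_norm_scale
      by (simp only: add.assoc add.commute add.left_commute char2_add mult.assoc mult.commute mult.left_commute)
    also have "\<dots> = (c 4)\<^sup>2 * (e\<^sub>1 * e\<^sub>2 * binary_norm g x\<^sub>0 x\<^sub>1 + e\<^sub>3 * binary_norm g y\<^sub>0 y\<^sub>1) + (c 4)\<^sup>2"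
      unfolding binary_norm_orthogonal_pair uv mult_1_right by (simp only: char2_ring)
    also have "\<dots> = 0" by (simp add: xy char2_add)
    finally show "quaternion_norm g e\<^sub>1 (?u 0 c) (?u 1 c) (?u 2 c) (?u 3 c)
      + quaternion_norm g e\<^sub>2 (?v 0 c) (?v 1 c) (?v 2 c) (?v 3 c)
      + quaternion_norm g e\<^sub>3 (?z 0 c) (?z 1 c) (?z 2 c) (?z 3 c) + (c 4)\<^sup>2 = 0"
      by (simp add: numeral_2_eq_2 numeral_3_eq_3)
  next
    fix i :: nat assume "i < 4"
    then have "i = 0 \<or> i = 1 \<or> i = 2 \<or> i = 3" by auto
    then show "linear_functional (?u i)" "linear_functional (?v i)" "linear_functional (?z i)"
      by (auto simp: linear_functional_def numeral_2_eq_2 numeral_3_eq_3) (simp_all add: algebra_simps)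
  next
    show "linear_functional (\<lambda>c::nat \<Rightarrow> 'a. c 4)" by (rule linear_functional_coord)
  next
    fix c :: "nat \<Rightarrow> 'a"
    assume "?u 0 c = 0" "?u 1 c = 0" "?z 0 c = 0" "?z 1 c = 0" "c 4 = 0"
    then show "c 0 = 0 \<and> c 1 = 0 \<and> c 2 = 0 \<and> c 3 = 0 \<and> c 4 = 0" by simp
  qed
qed

text \<open>Norms on the spans of 1 and y are additive of the shape a^2 + e b^2. Choosing the third
  \<open>e\<close>-coordinate as the sum of the other two, and \<open>w\<close> as the sum of the
  unit coordinates, leaves five free parameters.\<close>

lemma isotropic5_if_common_bilinear_factor:
  assumes emb: "norm_embedding p g\<^sub>1 e f\<^sub>1 A" "norm_embedding q g\<^sub>2 e f\<^sub>2 A"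
      "norm_embedding r g\<^sub>3 e (f\<^sub>1 + f\<^sub>2) b" and A: "A \<noteq> (0::'a)"
  shows "isotropic5 (f\<^sub>1 + f\<^sub>2) A (f\<^sub>1 + f\<^sub>2) b"
proof (rule isotropic5_if_isotropic_space[OF emb A, where u = "\<lambda>i c. [c 0, 0, c 1, 0] ! i"
      and v = "\<lambda>i c. [c 2, 0, c 3, 0] ! i" and z = "\<lambda>i c. [c 4, 0, c 1 + c 3, 0] ! i"
      and w = "\<lambda>c. c 0 + c 2 + c 4"])
  show "quaternion_norm g\<^sub>1 e ([c 0, 0, c 1, 0] ! 0) ([c 0, 0, c 1, 0] ! 1)
      ([c 0, 0, c 1, 0] ! 2) ([c 0, 0, c 1, 0] ! 3)
    + quaternion_norm g\<^sub>2 e ([c 2, 0, c 3, 0] ! 0) ([c 2, 0, c 3, 0] ! 1)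
      ([c 2, 0, c 3, 0] ! 2) ([c 2, 0, c 3, 0] ! 3)
    + quaternion_norm g\<^sub>3 e ([c 4, 0, c 1 + c 3, 0] ! 0) ([c 4, 0, c 1 + c 3, 0] ! 1)
      ([c 4, 0, c 1 + c 3, 0] ! 2) ([c 4, 0, c 1 + c 3, 0] ! 3)
    + (c 0 + c 2 + c 4)\<^sup>2 = 0" for c :: "nat \<Rightarrow> 'a"
    by (simp add: numeral_2_eq_2 numeral_3_eq_3 quaternion_norm_def char2_square_add)
      (simp only: char2_ring)
qed (auto simp: linear_functional_def less_Suc_eq numeral_nat algebra_simps)

lemma pfister3_isotropicI:
  assumes "quaternion_norm \<alpha> \<beta> x\<^sub>0 x\<^sub>1 x\<^sub>2 x\<^sub>3 + \<gamma> * quaternion_norm \<alpha> \<beta> y\<^sub>0 y\<^sub>1 y\<^sub>2 y\<^sub>3 = (0::'a)"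
    and "x\<^sub>0 \<noteq> 0 \<or> x\<^sub>1 \<noteq> 0 \<or> x\<^sub>2 \<noteq> 0 \<or> x\<^sub>3 \<noteq> 0 \<or> y\<^sub>0 \<noteq> 0 \<or> y\<^sub>1 \<noteq> 0 \<or> y\<^sub>2 \<noteq> 0 \<or> y\<^sub>3 \<noteq> 0"
  shows "pfister3_isotropic \<alpha> \<beta> \<gamma>"
  using assms unfolding pfister3_isotropic_def by blast

lemma pfister3_isotropic_if_norm_isotropic:
  assumes "quaternion_norm \<alpha> \<beta> a b c d = (0::'a)" and "a \<noteq> 0 \<or> b \<noteq> 0 \<or> c \<noteq> 0 \<or> d \<noteq> 0"
  shows "pfister3_isotropic \<alpha> \<beta> \<gamma>"
  by (rule pfister3_isotropicI[of \<alpha> \<beta> a b c d \<gamma> 0 0 0 0]) (use assms in \<open>auto simp: quaternion_norm_def\<close>)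

text \<open>
  The triple \<open>[f\<^sub>1, A), [f\<^sub>2, A), [f\<^sub>1 + f\<^sub>2, b)\<close> is chosen such that any two of its members share an
  inseparable quadratic extension, generated by a square root of \<open>A\<close>, of \<open>f\<^sub>1 / A\<close> (which equals \<open>b\<close>)
  and of \<open>f\<^sub>2 / A\<close>, respectively.
\<close>

lemma isotropic5_if_triple_linked:
  assumes linked: "norms_linked {(f\<^sub>1, A), (f\<^sub>2, A), (f\<^sub>1 + f\<^sub>2, b)}"
    and nz: "A \<noteq> 0" "f\<^sub>1 \<noteq> 0" "f\<^sub>2 \<noteq> 0" and b: "b = f\<^sub>1 / A"
    and z: "b * (f\<^sub>1 + f\<^sub>2) * z\<^sup>2 = f\<^sub>2 / A"
    and aniso: "\<And>x y x' y'. quaternion_norm (f\<^sub>1 + f\<^sub>2) b x y x' y' = 0 \<Longrightarrow>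
        x = 0 \<and> y = 0 \<and> x' = 0 \<and> y' = (0::'a)"
  shows "isotropic5 (f\<^sub>1 + f\<^sub>2) A (f\<^sub>1 + f\<^sub>2) b"
  using linked unfolding norms_linked_def
proof
  assume "\<exists>g. \<forall>(\<alpha>, \<beta>)\<in>{(f\<^sub>1, A), (f\<^sub>2, A), (f\<^sub>1 + f\<^sub>2, b)}. \<exists>e. e \<noteq> 0 \<and> norm_equiv \<alpha> \<beta> g e"
  then obtain g e\<^sub>1 e\<^sub>2 e\<^sub>3 p\<^sub>1 p\<^sub>2 p\<^sub>3 q\<^sub>1 q\<^sub>2 q\<^sub>3 where e: "e\<^sub>1 \<noteq> 0" "e\<^sub>2 \<noteq> 0" "e\<^sub>3 \<noteq> 0"
    and p: "norm_embedding p\<^sub>1 f\<^sub>1 A g e\<^sub>1" "norm_embedding p\<^sub>2 f\<^sub>2 A g e\<^sub>2"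
      "norm_embedding p\<^sub>3 (f\<^sub>1 + f\<^sub>2) b g e\<^sub>3"
    and q: "norm_embedding q\<^sub>1 g e\<^sub>1 f\<^sub>1 A" "norm_embedding q\<^sub>2 g e\<^sub>2 f\<^sub>2 A"
      "norm_embedding q\<^sub>3 g e\<^sub>3 (f\<^sub>1 + f\<^sub>2) b"
    unfolding norm_equiv_def by auto
  \<comment> \<open>Anisotropy of the third norm form carries over to its presentation with slot
    \<open>g\<close>.\<close>
  have "x = 0" if "quaternion_norm g e\<^sub>3 x y x' y' = 0" for x y x' y'
    using norm_embeddingD[OF q(3), of x y x' y'] aniso[of "row q\<^sub>3 0 x y x' y'"
        "row q\<^sub>3 1 x y x' y'" "row q\<^sub>3 2 x y x' y'" "row q\<^sub>3 3 x y x' y'"] that by simp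
  then have aniso': "\<forall>x y x' y'. quaternion_norm g e\<^sub>3 x y x' y' = 0 \<longrightarrow> x = 0" by blast
  \<comment> \<open>Pure elements with equal squares: x y / A in the first algebra and y in the
    third; x y / A in the second and z x y in the third.\<close>
  have f1: "A * binary_norm f\<^sub>1 0 (1 / A) = f\<^sub>1 / A" and f2: "A * binary_norm f\<^sub>2 0 (1 / A) = f\<^sub>2 / A"
    using nz by (simp_all add: binary_norm_def power2_eq_square)
  have "A * binary_norm f\<^sub>1 1 0 = A" "A * binary_norm f\<^sub>2 1 0 = A"
    and b1: "b * binary_norm (f\<^sub>1 + f\<^sub>2) 1 0 = f\<^sub>1 / A"
    and bz: "b * binary_norm (f\<^sub>1 + f\<^sub>2) 0 z = f\<^sub>2 / A"
    using b z by (simp_all add: binary_norm_def mult.assoc)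
  then obtain u\<^sub>0 u\<^sub>1 v\<^sub>0 v\<^sub>1 where
    12: "e\<^sub>1 * binary_norm g u\<^sub>0 u\<^sub>1 + e\<^sub>2 * binary_norm g v\<^sub>0 v\<^sub>1 = 1"
    using common_pure_square_imp_represents_1[OF p(1,2) e(1,2)] nz by blast
  obtain s t u v where 13: "e\<^sub>1 * binary_norm g s t + e\<^sub>3 * binary_norm g u v = 1"
    by (rule common_pure_square_imp_represents_1[OF p(1,3) e(1,3) f1 b1]) (use nz in auto)
  obtain s' t' u' v' where 23: "e\<^sub>2 * binary_norm g s' t' + e\<^sub>3 * binary_norm g u' v' = 1"
    by (rule common_pure_square_imp_represents_1[OF p(2,3) e(2,3) f2 bz]) (use nz in auto)
  obtain x\<^sub>0 x\<^sub>1 y\<^sub>0 y\<^sub>1 where "e\<^sub>1 * e\<^sub>2 * binary_norm g x\<^sub>0 x\<^sub>1 + e\<^sub>3 * binary_norm g y\<^sub>0 y\<^sub>1 = 1"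
    by (rule represents_1_mult[OF aniso' e(3,1,2) 13 23])
  then show ?thesis
    by (rule isotropic5_if_common_quadratic_factor[OF q nz(1) 12])
next
  assume "\<exists>e. e \<noteq> 0 \<and> (\<forall>(\<alpha>, \<beta>)\<in>{(f\<^sub>1, A), (f\<^sub>2, A), (f\<^sub>1 + f\<^sub>2, b)}. \<exists>g. norm_equiv \<alpha> \<beta> g e)"
  then obtain e g\<^sub>1 g\<^sub>2 g\<^sub>3 p q r where "norm_embedding p g\<^sub>1 e f\<^sub>1 A" "norm_embedding q g\<^sub>2 e f\<^sub>2 A"
      "norm_embedding r g\<^sub>3 e (f\<^sub>1 + f\<^sub>2) b"
    unfolding norm_equiv_def by auto
  then show ?thesis using isotropic5_if_common_bilinear_factor nz(1) by blast
qed

text \<open>After [1,c] is rewritten as [1,f] with e = f + z^2, the slots of a suitable triple add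
  up to f. The isotropic form obtained from the triple is then a subform of the 3-fold Pfister
  form.\<close>

lemma pfister3_isotropic_if_triples_linked:
  assumes linked: "\<And>a\<^sub>1 b\<^sub>1 a\<^sub>2 b\<^sub>2 a\<^sub>3 b\<^sub>3. b\<^sub>1 \<noteq> 0 \<Longrightarrow> b\<^sub>2 \<noteq> 0 \<Longrightarrow> b\<^sub>3 \<noteq> 0 \<Longrightarrow>
      norms_linked {(a\<^sub>1, b\<^sub>1), (a\<^sub>2, b\<^sub>2), (a\<^sub>3, b\<^sub>3 :: 'a)}"
    and b: "b \<noteq> 0" and e: "e \<noteq> (0::'a)"
  shows "pfister3_isotropic c b e"
proof -
  define z where "z = e + c"
  define f where "f = e + z\<^sup>2"
  have c: "c = e + z" unfolding z_def by (simp only: char2_ring)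
  have e_eq: "e = f + z\<^sup>2" unfolding f_def by (simp only: char2_ring)
  \<comment> \<open>c = f + z^2 + z, so the substitution x + z y identifies [1,f] with
    [1,c].\<close>
  have f_norm: "binary_norm f x y = binary_norm c (x + z * y) y" for x y
    unfolding binary_norm_def c f_def by (simp only: char2_ring)
  \<comment> \<open>f is the norm of t, and the arguments on the right are the coordinates of t (x +
    y t).\<close>
  have f_mult: "f * binary_norm f x y = binary_norm f (f * y) (x + y)" for x y
    unfolding binary_norm_def by (simp only: char2_ring)
  show ?thesis
  proof (cases "z = 0 \<or> f = 0 \<or> (\<exists>x y x' y'. quaternion_norm f b x y x' y' = 0 \<and>
      (x \<noteq> 0 \<or> y \<noteq> 0 \<or> x' \<noteq> 0 \<or> y' \<noteq> 0))")
    case True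
    then consider "z = 0" | "f = 0" | x y x' y' where "quaternion_norm f b x y x' y' = 0"
      "x \<noteq> 0 \<or> y \<noteq> 0 \<or> x' \<noteq> 0 \<or> y' \<noteq> 0" by blast
    then show ?thesis
    proof cases
      \<comment> \<open>Here e = c is a value of [1,c], so <1,e> * [1,c] is isotropic. In the next
        case [1,f] is [1,0], which is isotropic.\<close>
      case 1
      then have "quaternion_norm c b 0 1 0 0 + e * quaternion_norm c b 1 0 0 0 = 0"
        by (simp add: c quaternion_norm_def binary_norm_def char2_add)
      then show ?thesis by (rule pfister3_isotropicI) simp
    next
      case 2
      have "quaternion_norm c b (1 + z) 1 0 0 = binary_norm f 1 1"
        by (simp add: quaternion_norm_def f_norm)
      also have "\<dots> = 0" using 2 by (simp add: binary_norm_def char2_add)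
      finally show ?thesis by (rule pfister3_isotropic_if_norm_isotropic) simp
    next
      case (3 x y x' y')
      have "quaternion_norm c b (x + z * y) y (x' + z * y') y' = quaternion_norm f b x y x' y'"
        by (simp add: quaternion_norm_def f_norm)
      then show ?thesis
        using 3 by (intro pfister3_isotropic_if_norm_isotropic[of c b "x + z * y" y "x' + z * y'" y']) auto
    qed
  next
    case False
    then have z: "z \<noteq> 0" and f: "f \<noteq> 0"
      and aniso: "\<And>x y x' y'. quaternion_norm f b x y x' y' = 0 \<Longrightarrow> x = 0 \<and> y = 0 \<and> x' = 0 \<and> y' = 0"
      by blast+
    define A where "A = f * z\<^sup>2 / (b * e)"
    define f\<^sub>1 where "f\<^sub>1 = f * z\<^sup>2 / e"
    define f\<^sub>2 where "f\<^sub>2 = f * f / e"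
    have "f\<^sub>1 + f\<^sub>2 = f * (f + z\<^sup>2) / e"
      unfolding f\<^sub>1_def f\<^sub>2_def by (simp add: distrib_left add_divide_distrib add.commute)
    then have sum: "f\<^sub>1 + f\<^sub>2 = f" using e by (simp add: e_eq[symmetric])
    have nz: "A \<noteq> 0" "f\<^sub>1 \<noteq> 0" "f\<^sub>2 \<noteq> 0" using z f b e by (simp_all add: A_def f\<^sub>1_def f\<^sub>2_def)
    have "b = f\<^sub>1 / A" "b * f * (1 / z)\<^sup>2 = f\<^sub>2 / A"
      using z f b e by (simp_all add: A_def f\<^sub>1_def f\<^sub>2_def power2_eq_square)
    then have "isotropic5 f A f b"
      by (intro isotropic5_if_triple_linked[of f\<^sub>1 A f\<^sub>2 b "1 / z", unfolded sum] linked nz b aniso)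
    then obtain x\<^sub>1 y\<^sub>1 x\<^sub>2 y\<^sub>2 t where xyt: "x\<^sub>1 \<noteq> 0 \<or> y\<^sub>1 \<noteq> 0 \<or> x\<^sub>2 \<noteq> 0 \<or> y\<^sub>2 \<noteq> 0 \<or> t \<noteq> 0"
      and eq: "A * binary_norm f x\<^sub>1 y\<^sub>1 + b * binary_norm f x\<^sub>2 y\<^sub>2 + t\<^sup>2 = 0"
      unfolding isotropic5_def by blast
    \<comment> \<open>A equals e b f up to the square of \<open>k\<close>, and f is a norm from K.
      Hence A [1,f] can be replaced by e b [1,f], a summand of the Pfister form.\<close>
    define k where "k = z / (b * e)"
    have k: "k \<noteq> 0" using z b e by (simp add: k_def)
    define X where "X = k * (f * y\<^sub>1)"
    define Y where "Y = k * (x\<^sub>1 + y\<^sub>1)"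
    have "A = e * b * k\<^sup>2 * f" using b e by (simp add: A_def k_def power2_eq_square)
    then have "A * binary_norm f x\<^sub>1 y\<^sub>1 = e * b * (k\<^sup>2 * (f * binary_norm f x\<^sub>1 y\<^sub>1))"
      by (simp add: mult_ac)
    also have "\<dots> = e * b * binary_norm f X Y"
      by (simp only: f_mult X_def Y_def binary_norm_scale)
    finally have AXY: "A * binary_norm f x\<^sub>1 y\<^sub>1 = e * b * binary_norm f X Y" .
    have "quaternion_norm c b t 0 (x\<^sub>2 + z * y\<^sub>2) y\<^sub>2 + e * quaternion_norm c b 0 0 (X + z * Y) Y
      = A * binary_norm f x\<^sub>1 y\<^sub>1 + b * binary_norm f x\<^sub>2 y\<^sub>2 + t\<^sup>2"
      unfolding quaternion_norm_def binary_norm_x_0 f_norm[symmetric] AXY by (simp add: mult.assoc)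
    then have "quaternion_norm c b t 0 (x\<^sub>2 + z * y\<^sub>2) y\<^sub>2 + e * quaternion_norm c b 0 0 (X + z * Y) Y = 0"
      using eq by simp
    moreover have "t \<noteq> 0 \<or> x\<^sub>2 + z * y\<^sub>2 \<noteq> 0 \<or> y\<^sub>2 \<noteq> 0 \<or> X + z * Y \<noteq> 0 \<or> Y \<noteq> 0"
      using xyt k f by (auto simp: X_def Y_def)
    ultimately show ?thesis by (intro pfister3_isotropicI) auto
  qed
qed

end

section \<open>Forms as functions on vectors\<close>

lemma qdim_simps [simp]:
  "qdim (binary_form a b) = 2" "qdim (scale_form c q) = qdim q"
  "qdim (p \<bottom>\<^sub>q q) = qdim p + qdim q" "qdim zero_form = 0"
  by (simp_all add: binary_form_def scale_form_def orth_sum_def zero_form_def)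

lemma qval_simps:
  "qval (binary_form a b) v = a * (v $ 0)\<^sup>2 + v $ 0 * v $ 1 + b * (v $ 1)\<^sup>2"
  "qval (scale_form c q) v = c * qval q v"
  "qval zero_form v = 0"
  by (simp_all add: binary_form_def scale_form_def zero_form_def)

lemma qval_orth_sum:
  assumes "v \<in> carrier_vec (qdim p + qdim q)"
  shows "qval (p \<bottom>\<^sub>q q) v
    = qval p (vec (qdim p) (\<lambda>i. v $ i)) + qval q (vec (qdim q) (\<lambda>i. v $ (qdim p + i)))"
  using assms by (simp add: orth_sum_def vec_first_def vec_last_def)

lemma diag_tensor_simps:
  "diag_tensor [] q = zero_form"
  "diag_tensor (a # as) q = scale_form a q \<bottom>\<^sub>q diag_tensor as q"
  by (simp_all add: diag_tensor_def)

lemma pfister_simps: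
  "pfister [\<beta>] \<alpha> = diag_tensor [1, \<beta>] (binary_form 1 \<alpha>)"
  "pfister [\<gamma>, \<beta>] \<alpha> = diag_tensor [1, \<gamma>] (pfister [\<beta>] \<alpha>)"
  by (simp_all add: pfister_def)

lemma qdim_pfister [simp]:
  "qdim (pfister [\<beta>] \<alpha>) = 4" "qdim (pfister [\<gamma>, \<beta>] \<alpha>) = 8"
  by (simp_all add: pfister_simps diag_tensor_simps)

lemma qval_diag_tensor_pair:
  assumes "v \<in> carrier_vec (2 * qdim q)"
  shows "qval (diag_tensor [1, a] q) v
    = qval q (vec (qdim q) (\<lambda>i. v $ i)) + a * qval q (vec (qdim q) (\<lambda>i. v $ (qdim q + i)))"
proof -
  have "vec n (\<lambda>i. vec n f $ i) = vec n f" for n and f :: "nat \<Rightarrow> 'a"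
    by (rule eq_vecI) simp_all
  then show ?thesis using assms by (simp add: diag_tensor_simps qval_orth_sum qval_simps mult_2)
qed

lemma qval_pfister_1:
  assumes "v \<in> carrier_vec 4"
  shows "qval (pfister [\<beta>] \<alpha>) v = quaternion_norm \<alpha> \<beta> (v $ 0) (v $ 1) (v $ 2) (v $ 3)"
  using assms
  by (simp add: pfister_simps qval_diag_tensor_pair qval_simps quaternion_norm_def binary_norm_def)
    (simp add: numeral_2_eq_2 numeral_3_eq_3)

lemma qval_pfister_2:
  assumes "v \<in> carrier_vec 8"
  shows "qval (pfister [\<gamma>, \<beta>] \<alpha>) v = quaternion_norm \<alpha> \<beta> (v $ 0) (v $ 1) (v $ 2) (v $ 3)
    + \<gamma> * quaternion_norm \<alpha> \<beta> (v $ 4) (v $ 5) (v $ 6) (v $ 7)"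
  using assms
  by (simp add: pfister_simps(2) qval_diag_tensor_pair qval_pfister_1)

lemma qdim_hyperbolic [simp]: "qdim (hyperbolic m) = 2 * m"
  by (induction m) (simp_all add: hyperbolic_def diag_tensor_simps)

lemma qval_hyperbolic:
  "v \<in> carrier_vec (2 * m) \<Longrightarrow> qval (hyperbolic m) v = (\<Sum>l<m. v $ (2 * l) * v $ (2 * l + 1))"
proof (induction m arbitrary: v)
  case 0
  then show ?case by (simp add: hyperbolic_def diag_tensor_simps qval_simps)
next
  case (Suc m)
  have H: "hyperbolic (Suc m) = scale_form 1 (binary_form 0 0) \<bottom>\<^sub>q (hyperbolic m :: 'a qform)"
    by (simp add: hyperbolic_def diag_tensor_simps)
  have "qval (hyperbolic (Suc m)) v
      = v $ 0 * v $ 1 + qval (hyperbolic m) (vec (2 * m) (\<lambda>i. v $ (2 + i)))"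
    unfolding H using Suc.prems by (subst qval_orth_sum) (simp_all add: qval_simps)
  also have "qval (hyperbolic m) (vec (2 * m) (\<lambda>i. v $ (2 + i)))
      = (\<Sum>l<m. v $ (2 * Suc l) * v $ (2 * Suc l + 1))"
    by (subst Suc.IH) simp_all
  finally show ?case by (simp add: sum.lessThan_Suc_shift del: sum.lessThan_Suc)
qed

section \<open>Isometry as an equivalence relation and its coordinate version\<close>

lemma invertible_mat_inverse:
  assumes "P \<in> carrier_mat n n" and "invertible_mat P"
  obtains Q where "Q \<in> carrier_mat n n" and "P * Q = 1\<^sub>m n" and "Q * P = 1\<^sub>m n"
proof -
  obtain Q where Q: "inverts_mat P Q" "inverts_mat Q P"
    using assms(2) unfolding invertible_mat_def by blast
  have PQ: "P * Q = 1\<^sub>m n" and QP: "Q * P = 1\<^sub>m (dim_row Q)"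
    using Q assms(1) unfolding inverts_mat_def by auto
  \<comment> \<open>\<open>inverts_mat\<close> leaves the shape of \<open>Q\<close> open; comparing
    column counts fixes it.\<close>
  have "dim_col Q = n" using arg_cong[OF PQ, of dim_col] by simp
  moreover have "dim_row Q = n" using arg_cong[OF QP, of dim_col] assms(1) by simp
  ultimately show thesis using that PQ QP by auto
qed

lemma invertible_matI:
  assumes "P \<in> carrier_mat n n" "Q \<in> carrier_mat n n" "P * Q = 1\<^sub>m n" "Q * P = 1\<^sub>m n"
  shows "invertible_mat P"
  using assms unfolding invertible_mat_def inverts_mat_def by (auto intro!: exI[of _ Q])

lemma isometric_refl: "q \<cong>\<^sub>q q"
  unfolding isometric_def
  by (auto intro!: bexI[of _ "1\<^sub>m (qdim q)"] invertible_matI[where Q = "1\<^sub>m (qdim q)"])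

lemma isometric_sym:
  assumes "p \<cong>\<^sub>q q"
  shows "q \<cong>\<^sub>q p"
proof -
  let ?n = "qdim p"
  obtain P where dim: "qdim p = qdim q" and P: "P \<in> carrier_mat ?n ?n" "invertible_mat P"
    and val: "\<And>v. v \<in> carrier_vec ?n \<Longrightarrow> qval q (P *\<^sub>v v) = qval p v"
    using assms unfolding isometric_def by blast
  obtain Q where Q: "Q \<in> carrier_mat ?n ?n" "P * Q = 1\<^sub>m ?n" "Q * P = 1\<^sub>m ?n"
    using invertible_mat_inverse[OF P] by blast
  have "qval p (Q *\<^sub>v v) = qval q v" if v: "v \<in> carrier_vec ?n" for v
  proof -
    have "P *\<^sub>v (Q *\<^sub>v v) = v"
      using P Q v by (simp add: assoc_mult_mat_vec[symmetric])
    then show ?thesis using val[of "Q *\<^sub>v v"] Q v by simp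
  qed
  moreover have "invertible_mat Q" using invertible_matI[OF Q(1) P(1) Q(3) Q(2)] .
  ultimately show ?thesis using dim Q unfolding isometric_def by auto
qed

lemma isometric_trans:
  assumes "p \<cong>\<^sub>q q" "q \<cong>\<^sub>q r"
  shows "p \<cong>\<^sub>q r"
proof -
  let ?n = "qdim p"
  obtain P where dim: "qdim p = qdim q" and P: "P \<in> carrier_mat ?n ?n" "invertible_mat P"
    and val: "\<And>v. v \<in> carrier_vec ?n \<Longrightarrow> qval q (P *\<^sub>v v) = qval p v"
    using assms(1) unfolding isometric_def by blast
  obtain R where dim': "qdim q = qdim r" and R: "R \<in> carrier_mat ?n ?n" "invertible_mat R"
    and val': "\<And>v. v \<in> carrier_vec ?n \<Longrightarrow> qval r (R *\<^sub>v v) = qval q v"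
    using assms(2) dim unfolding isometric_def by auto
  have "qval r ((R * P) *\<^sub>v v) = qval p v" if v: "v \<in> carrier_vec ?n" for v
    using assoc_mult_mat_vec[OF R(1) P(1) v] val[OF v] val'[of "P *\<^sub>v v"] P v by simp
  moreover have "invertible_mat (R * P)"
  proof -
    obtain P' where P': "P' \<in> carrier_mat ?n ?n" "P * P' = 1\<^sub>m ?n" "P' * P = 1\<^sub>m ?n"
      using invertible_mat_inverse[OF P] by blast
    obtain R' where R': "R' \<in> carrier_mat ?n ?n" "R * R' = 1\<^sub>m ?n" "R' * R = 1\<^sub>m ?n"
      using invertible_mat_inverse[OF R] by blast
    have "(R * P) * (P' * R') = R * ((P * P') * R')" "(P' * R') * (R * P) = P' * ((R' * R) * P)"
      using P(1) R(1) P'(1) R'(1) by (simp_all add: assoc_mult_mat[of _ ?n ?n _ ?n _ ?n])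
    then show ?thesis
      using P R P' R' by (intro invertible_matI[of _ ?n "P' * R'"]) auto
  qed
  ultimately show ?thesis using dim dim' P R unfolding isometric_def by auto
qed

lemma norm_embedding_if_isometric:
  assumes "pfister [\<beta>] \<alpha> \<cong>\<^sub>q pfister [\<beta>'] \<alpha>'"
  shows "\<exists>p. norm_embedding p \<alpha> \<beta> \<alpha>' \<beta>'"
proof -
  obtain P where P: "P \<in> carrier_mat 4 4" "invertible_mat P"
    and val: "\<And>v. v \<in> carrier_vec 4 \<Longrightarrow> qval (pfister [\<beta>'] \<alpha>') (P *\<^sub>v v) = qval (pfister [\<beta>] \<alpha>) v"
    using assms unfolding isometric_def by auto
  obtain Q where Q: "Q \<in> carrier_mat 4 4" "Q * P = 1\<^sub>m 4"
    using invertible_mat_inverse[OF P] by blast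
  let ?v = "\<lambda>a b c d. vec 4 (\<lambda>i. [a, b, c, d] ! i)"
  let ?p = "\<lambda>i j. P $$ (i, j)"
  have idx: "(P *\<^sub>v ?v a b c d) $ i = row ?p i a b c d" if "i < 4" for i a b c d
    using that P by (simp add: scalar_prod_def row_def eval_nat_numeral)
  have "quaternion_norm \<alpha>' \<beta>' (row ?p 0 a b c d) (row ?p 1 a b c d) (row ?p 2 a b c d) (row ?p 3 a b c d)
      = quaternion_norm \<alpha> \<beta> a b c d" for a b c d
    using val[of "?v a b c d"] P
    by (simp add: qval_pfister_1 idx del: index_mult_mat_vec)
  moreover have "a = 0 \<and> b = 0 \<and> c = 0 \<and> d = 0"
    if "row ?p 0 a b c d = 0" "row ?p 1 a b c d = 0" "row ?p 2 a b c d = 0" "row ?p 3 a b c d = 0"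
    for a b c d
  proof -
    have "P *\<^sub>v ?v a b c d = 0\<^sub>v 4"
    proof (rule eq_vecI)
      fix i assume "i < dim_vec (0\<^sub>v 4 :: 'a vec)"
      then have "i = 0 \<or> i = 1 \<or> i = 2 \<or> i = 3" by auto
      then show "(P *\<^sub>v ?v a b c d) $ i = 0\<^sub>v 4 $ i"
        using that by (auto simp: idx simp del: index_mult_mat_vec)
    qed (use P in simp)
    then have "(Q * P) *\<^sub>v ?v a b c d = Q *\<^sub>v 0\<^sub>v 4"
      using assoc_mult_mat_vec[OF Q(1) P(1), of "?v a b c d"] by simp
    moreover have "Q *\<^sub>v 0\<^sub>v 4 = 0\<^sub>v 4" by (rule eq_vecI) (use Q in auto)
    ultimately have "?v a b c d = 0\<^sub>v 4" using Q by simp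
    then have "?v a b c d $ i = 0" if "i < 4" for i using that by simp
    from this[of 0] this[of 1] this[of 2] this[of 3] show ?thesis by (simp add: eval_nat_numeral)
  qed
  ultimately show ?thesis unfolding norm_embedding_def by blast
qed

lemma norm_equiv_if_isometric:
  "pfister [\<beta>] \<alpha> \<cong>\<^sub>q pfister [\<beta>'] \<alpha>' \<Longrightarrow> norm_equiv \<alpha> \<beta> \<alpha>' \<beta>'"
  unfolding norm_equiv_def using norm_embedding_if_isometric isometric_sym by blast

lemma invertible_mat_if_injective:
  fixes P :: "'a::field mat"
  assumes P: "P \<in> carrier_mat n n"
    and inj: "\<And>v. v \<in> carrier_vec n \<Longrightarrow> P *\<^sub>v v = 0\<^sub>v n \<Longrightarrow> v = 0\<^sub>v n"
  shows "invertible_mat P"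
proof -
  have "det P \<noteq> 0" using inj det_0_iff_vec_prod_zero_field[OF P] by auto
  from det_non_zero_imp_unit[OF P this, of "()"] obtain Q where
    "Q \<in> carrier_mat n n" "Q * P = 1\<^sub>m n" "P * Q = 1\<^sub>m n"
    unfolding Units_def ring_mat_def by auto
  then show ?thesis using invertible_matI[OF P] by blast
qed

lemma scale_form_1 [simp]: "scale_form 1 q = q"
  by (simp add: scale_form_def)

lemma witt_rel_refl: "nonsingular q \<Longrightarrow> (q, q) \<in> witt_rel"
  unfolding witt_rel_def using isometric_refl by blast

section \<open>Vanishing of the third power I_q^3 and isotropy of 3-fold Pfister forms\<close>

context char2_field
begin

lemma polar_pfister_2:
  fixes v w :: "'a vec"
  assumes "v \<in> carrier_vec 8" "w \<in> carrier_vec 8"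
  shows "polar (pfister [\<gamma>, \<beta>] \<alpha>) v w = v $ 0 * w $ 1 + w $ 0 * v $ 1
    + \<beta> * (v $ 2 * w $ 3 + w $ 2 * v $ 3)
    + \<gamma> * (v $ 4 * w $ 5 + w $ 4 * v $ 5 + \<beta> * (v $ 6 * w $ 7 + w $ 6 * v $ 7))"
proof -
  have "qval (pfister [\<gamma>, \<beta>] \<alpha>) (v + w) = quaternion_norm \<alpha> \<beta> (v $ 0 + w $ 0) (v $ 1 + w $ 1)
      (v $ 2 + w $ 2) (v $ 3 + w $ 3)
      + \<gamma> * quaternion_norm \<alpha> \<beta> (v $ 4 + w $ 4) (v $ 5 + w $ 5) (v $ 6 + w $ 6) (v $ 7 + w $ 7)"
    using assms by (simp add: qval_pfister_2)
  then show ?thesis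
    unfolding polar_def qval_pfister_2[OF assms(1)] qval_pfister_2[OF assms(2)] char2_diff
      quaternion_norm_def binary_norm_add
    by (simp only: char2_ring)
qed

lemma nonsingular_pfister_2:
  assumes "\<beta> \<noteq> 0" "\<gamma> \<noteq> (0::'a)"
  shows "nonsingular (pfister [\<gamma>, \<beta>] \<alpha>)"
  unfolding nonsingular_def quadratic_form_def qdim_pfister
proof (intro conjI allI ballI impI)
  fix c :: 'a and u v w :: "'a vec"
  assume v: "v \<in> carrier_vec 8"
  then show "qval (pfister [\<gamma>, \<beta>] \<alpha>) (c \<cdot>\<^sub>v v) = c\<^sup>2 * qval (pfister [\<gamma>, \<beta>] \<alpha>) v"
    by (simp add: qval_pfister_2 quaternion_norm_scale distrib_left mult.left_commute)
  assume w: "w \<in> carrier_vec 8"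
  show "polar (pfister [\<gamma>, \<beta>] \<alpha>) (c \<cdot>\<^sub>v v) w = c * polar (pfister [\<gamma>, \<beta>] \<alpha>) v w"
    using v w by (simp add: polar_pfister_2 algebra_simps)
  assume u: "u \<in> carrier_vec 8"
  show "polar (pfister [\<gamma>, \<beta>] \<alpha>) (u + v) w
      = polar (pfister [\<gamma>, \<beta>] \<alpha>) u w + polar (pfister [\<gamma>, \<beta>] \<alpha>) v w"
    using u v w by (simp add: polar_pfister_2 algebra_simps)
next
  fix v :: "'a vec"
  assume v: "v \<in> carrier_vec 8"
    and orth: "\<forall>w\<in>carrier_vec 8. polar (pfister [\<gamma>, \<beta>] \<alpha>) v w = 0"
  \<comment> \<open>Pairing with a unit vector returns the partner coordinate times 1, \<beta>,
    \<gamma> or \<gamma>\<beta>.\<close>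
  have *: "polar (pfister [\<gamma>, \<beta>] \<alpha>) v (unit_vec 8 i) = 0" for i using orth by simp
  have "v $ 0 = 0 \<and> v $ 1 = 0 \<and> v $ 2 = 0 \<and> v $ 3 = 0 \<and> v $ 4 = 0 \<and> v $ 5 = 0 \<and> v $ 6 = 0 \<and> v $ 7 = 0"
    using *[of 0] *[of 1] *[of 2] *[of 3] *[of 4] *[of 5] *[of 6] *[of 7] assms v
    by (simp add: polar_pfister_2)
  moreover have "i = 0 \<or> i = 1 \<or> i = 2 \<or> i = 3 \<or> i = 4 \<or> i = 5 \<or> i = 6 \<or> i = 7" if "i < 8" for i :: nat
    using that by auto
  ultimately show "v = 0\<^sub>v 8" using v by (intro eq_vecI) auto
qed

text \<open>A Pfister form of trivial Witt class becomes m planes after adding n planes, where m = n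
  + 4. These m planes contain a totally isotropic space of dimension m > n.\<close>

lemma pfister3_isotropic_if_I3q_trivial:
  assumes I3q: "(I3q :: 'a qform set set) = {\<one>\<^bsub>witt_group\<^esub>}"
    and \<beta>: "\<beta> \<noteq> 0" and \<gamma>: "\<gamma> \<noteq> (0::'a)"
  shows "pfister3_isotropic \<alpha> \<beta> \<gamma>"
proof -
  let ?q = "pfister [\<gamma>, \<beta>] \<alpha>"
  have "witt_class (scale_form 1 ?q) \<in> I3q"
    unfolding I3q_def
    by (rule generate.incl, rule CollectI, rule exI[of _ \<gamma>], rule exI[of _ \<beta>], rule exI[of _ \<alpha>],
        rule exI[of _ 1]) (use \<beta> \<gamma> in simp)
  then have "witt_class ?q \<in> {\<one>\<^bsub>witt_group\<^esub>}" unfolding I3q by simp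
  then have "witt_class ?q = witt_class zero_form" by (simp add: witt_group_def)
  moreover have "?q \<in> witt_class ?q"
    unfolding witt_class_def using witt_rel_refl[OF nonsingular_pfister_2[OF \<beta> \<gamma>]] by simp
  ultimately have "(zero_form, ?q) \<in> witt_rel" unfolding witt_class_def by simp
  then obtain m n where "zero_form \<bottom>\<^sub>q hyperbolic m \<cong>\<^sub>q ?q \<bottom>\<^sub>q hyperbolic n"
    unfolding witt_rel_def by auto
  then obtain P where dim: "2 * m = 8 + 2 * n" and P: "P \<in> carrier_mat (2 * m) (2 * m)" "invertible_mat P"
    and val: "\<And>v. v \<in> carrier_vec (2 * m) \<Longrightarrow>
      qval (?q \<bottom>\<^sub>q hyperbolic n) (P *\<^sub>v v) = qval (zero_form \<bottom>\<^sub>q hyperbolic m) v"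
    unfolding isometric_def by auto
  \<comment> \<open>\<open>E\<close> puts one parameter on the first axis of each hyperbolic plane,
    where x y vanishes.\<close>
  define E where "E c = vec (2 * m) (\<lambda>i. if even i then c (i div 2) else 0)" for c :: "nat \<Rightarrow> 'a"
  define V where "V j c = (P *\<^sub>v E c) $ j" for j c
  have E: "E c \<in> carrier_vec (2 * m)" for c unfolding E_def by simp
  have PE: "P *\<^sub>v E c \<in> carrier_vec (2 * m)" for c using P E by simp
  have V: "linear_functional (V j)" if "j < 2 * m" for j
    unfolding linear_functional_def
  proof (intro conjI allI)
    fix c d :: "nat \<Rightarrow> 'a" and k
    have "E (\<lambda>i. c i + d i) = E c + E d" unfolding E_def by (intro eq_vecI) auto
    then show "V j (\<lambda>i. c i + d i) = V j c + V j d"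
      unfolding V_def using mult_add_distrib_mat_vec[OF P(1) E E, of c d] that P PE[of d]
      by (simp del: index_mult_mat_vec)
    have "E (\<lambda>i. k * c i) = k \<cdot>\<^sub>v E c" unfolding E_def by (intro eq_vecI) auto
    then show "V j (\<lambda>i. k * c i) = k * V j c"
      unfolding V_def using mult_mat_vec[OF P(1) E, of k c] that P PE[of c]
      by (simp del: index_mult_mat_vec)
  qed
  let ?f = "\<lambda>c. quaternion_norm \<alpha> \<beta> (V 0 c) (V 1 c) (V 2 c) (V 3 c)
      + \<gamma> * quaternion_norm \<alpha> \<beta> (V 4 c) (V 5 c) (V 6 c) (V 7 c)"
  let ?Z = "\<lambda>c. V 0 c = 0 \<and> V 1 c = 0 \<and> V 2 c = 0 \<and> V 3 c = 0
      \<and> V 4 c = 0 \<and> V 5 c = 0 \<and> V 6 c = 0 \<and> V 7 c = 0"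
  let ?XYs = "map (\<lambda>l. (V (8 + 2 * l), V (8 + 2 * l + 1))) [0..<n]"
  obtain c where "?f c = 0" "\<not> ?Z c"
  proof (rule isotropic_if_large_isotropic_space[of ?XYs ?f ?Z m])
    show "linear_functional X \<and> linear_functional Y" if "(X, Y) \<in> set ?XYs" for X Y
      using that V dim by auto
    show "?f c + (\<Sum>(X, Y)\<leftarrow>?XYs. X c * Y c) = 0" for c
    proof -
      have "qval (zero_form \<bottom>\<^sub>q hyperbolic m) (E c) = 0"
        using E[of c] by (simp add: qval_orth_sum qval_simps qval_hyperbolic) (simp add: E_def)
      moreover have "qval (?q \<bottom>\<^sub>q hyperbolic n) (P *\<^sub>v E c)
          = ?f c + (\<Sum>l<n. V (8 + 2 * l) c * V (8 + 2 * l + 1) c)"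
        using PE[of c] dim
        by (simp add: qval_orth_sum qval_pfister_2 qval_hyperbolic V_def del: index_mult_mat_vec)
      moreover have "(\<Sum>(X, Y)\<leftarrow>?XYs. X c * Y c) = (\<Sum>l<n. V (8 + 2 * l) c * V (8 + 2 * l + 1) c)"
        by (simp add: o_def interv_sum_list_conv_sum_set_nat atLeast0LessThan)
      ultimately show ?thesis using val[OF E] by simp
    qed
    show "?f (\<lambda>i. c i + d i) = ?f d" if "?Z c" for c d
    proof -
      have "V j (\<lambda>i. c i + d i) = V j c + V j d" if "j < 8" for j
        using that dim linear_functional_add[OF V] by simp
      then show ?thesis using that by simp
    qed
    show "c i = 0" if Z: "?Z c" and XY: "\<And>X Y. (X, Y) \<in> set ?XYs \<Longrightarrow> X c = 0 \<and> Y c = 0"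
      and i: "i < m" for c i
    proof -
      have "V j c = 0" if j: "j < 2 * m" for j
      proof (cases "j < 8")
        case True
        then have "j = 0 \<or> j = 1 \<or> j = 2 \<or> j = 3 \<or> j = 4 \<or> j = 5 \<or> j = 6 \<or> j = 7" by auto
        then show ?thesis using Z by auto
      next
        case False
        \<comment> \<open>Coordinates from 8 on come in pairs, one pair per plane; \<open>l\<close>
          is the number of the plane containing \<open>j\<close>.\<close>
        define l where "l = (j - 8) div 2"
        have "l < n" using False j dim by (auto simp: l_def)
        then have "V (8 + 2 * l) c = 0 \<and> V (8 + 2 * l + 1) c = 0" by (intro XY) auto
        moreover have "j = 8 + 2 * l \<or> j = 8 + 2 * l + 1" using False by (auto simp: l_def)
        ultimately show ?thesis by auto
      qed
      then have P0: "P *\<^sub>v E c = 0\<^sub>v (2 * m)"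
        using PE[of c] P(1) unfolding V_def by (intro eq_vecI) auto
      obtain Q where Q: "Q \<in> carrier_mat (2 * m) (2 * m)" "Q * P = 1\<^sub>m (2 * m)"
        using invertible_mat_inverse[OF P] by blast
      have "E c = Q *\<^sub>v (P *\<^sub>v E c)" using assoc_mult_mat_vec[OF Q(1) P(1) E] Q E by simp
      also have "\<dots> = 0\<^sub>v (2 * m)" unfolding P0 by (rule eq_vecI) (use Q in auto)
      finally have "E c $ (2 * i) = 0" using i by simp
      then show ?thesis using i by (simp add: E_def)
    qed
    show "length ?XYs < m" using dim by simp
  qed
  then show ?thesis by (intro pfister3_isotropicI) auto
qed

end

section \<open>Invariance of the norm form\<close>

context char2_field
begin

text \<open>
  Here \<open>(z\<^sub>0, z\<^sub>1, z\<^sub>2, z\<^sub>3)\<close> is the product \<open>x y\<close> in \<open>[\<alpha>,\<beta>)\<close>. The hypotheses say that \<open>x\<close> has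
  trace 1, that \<open>y\<close> has trace 0, and that \<open>x\<close> and \<open>y\<close> are orthogonal for the polar form of the norm.
\<close>

lemma quaternion_norm_change_generators:
  assumes x: "x\<^sub>1 = 1" and y: "y\<^sub>1 = 0" and orth: "y\<^sub>0 + \<beta> * (x\<^sub>2 * y\<^sub>3 + x\<^sub>3 * y\<^sub>2) = (0::'a)"
    and z: "z\<^sub>0 = x\<^sub>0 * y\<^sub>0 + \<alpha> * x\<^sub>1 * y\<^sub>1 + \<beta> * (x\<^sub>2 * (y\<^sub>2 + y\<^sub>3) + \<alpha> * x\<^sub>3 * y\<^sub>3)"
      "z\<^sub>1 = x\<^sub>0 * y\<^sub>1 + x\<^sub>1 * y\<^sub>0 + x\<^sub>1 * y\<^sub>1 + \<beta> * (x\<^sub>2 * y\<^sub>3 + x\<^sub>3 * y\<^sub>2)"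
      "z\<^sub>2 = x\<^sub>0 * y\<^sub>2 + \<alpha> * x\<^sub>1 * y\<^sub>3 + x\<^sub>2 * (y\<^sub>0 + y\<^sub>1) + \<alpha> * x\<^sub>3 * y\<^sub>1"
      "z\<^sub>3 = x\<^sub>0 * y\<^sub>3 + x\<^sub>1 * y\<^sub>2 + x\<^sub>1 * y\<^sub>3 + x\<^sub>2 * y\<^sub>1 + x\<^sub>3 * y\<^sub>0"
    and x_norm: "quaternion_norm \<alpha> \<beta> x\<^sub>0 x\<^sub>1 x\<^sub>2 x\<^sub>3 = \<alpha>'"
    and y_norm: "quaternion_norm \<alpha> \<beta> y\<^sub>0 y\<^sub>1 y\<^sub>2 y\<^sub>3 = \<beta>'"
  shows "quaternion_norm \<alpha> \<beta> (a + b * x\<^sub>0 + c * y\<^sub>0 + d * z\<^sub>0) (b * x\<^sub>1 + c * y\<^sub>1 + d * z\<^sub>1)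
      (b * x\<^sub>2 + c * y\<^sub>2 + d * z\<^sub>2) (b * x\<^sub>3 + c * y\<^sub>3 + d * z\<^sub>3) = quaternion_norm \<alpha>' \<beta>' a b c d"
proof -
  define pol where "pol a b c d a' b' c' d' = a * b' + b * a' + \<beta> * (c * d' + d * c')"
    for a b c d a' b' c' d' :: 'a
  have "quaternion_norm \<alpha> \<beta> (a + b * x\<^sub>0 + c * y\<^sub>0 + d * z\<^sub>0) (b * x\<^sub>1 + c * y\<^sub>1 + d * z\<^sub>1)
      (b * x\<^sub>2 + c * y\<^sub>2 + d * z\<^sub>2) (b * x\<^sub>3 + c * y\<^sub>3 + d * z\<^sub>3)
    = a\<^sup>2 + b\<^sup>2 * quaternion_norm \<alpha> \<beta> x\<^sub>0 x\<^sub>1 x\<^sub>2 x\<^sub>3 + c\<^sup>2 * quaternion_norm \<alpha> \<beta> y\<^sub>0 y\<^sub>1 y\<^sub>2 y\<^sub>3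
      + d\<^sup>2 * quaternion_norm \<alpha> \<beta> z\<^sub>0 z\<^sub>1 z\<^sub>2 z\<^sub>3 + a * b * x\<^sub>1 + a * c * y\<^sub>1 + a * d * z\<^sub>1
      + b * c * pol x\<^sub>0 x\<^sub>1 x\<^sub>2 x\<^sub>3 y\<^sub>0 y\<^sub>1 y\<^sub>2 y\<^sub>3 + b * d * pol x\<^sub>0 x\<^sub>1 x\<^sub>2 x\<^sub>3 z\<^sub>0 z\<^sub>1 z\<^sub>2 z\<^sub>3
      + c * d * pol y\<^sub>0 y\<^sub>1 y\<^sub>2 y\<^sub>3 z\<^sub>0 z\<^sub>1 z\<^sub>2 z\<^sub>3"
    unfolding quaternion_norm_def binary_norm_def pol_def
    by (simp only: char2_square_add power_mult_distrib) (simp only: char2_ring)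
  \<comment> \<open>The polar product of x and x y is N(x) times the trace of y; likewise that of y
    and x y is N(y) times the trace of x.\<close>
  moreover have "pol x\<^sub>0 x\<^sub>1 x\<^sub>2 x\<^sub>3 z\<^sub>0 z\<^sub>1 z\<^sub>2 z\<^sub>3 = quaternion_norm \<alpha> \<beta> x\<^sub>0 x\<^sub>1 x\<^sub>2 x\<^sub>3 * y\<^sub>1"
    unfolding pol_def z quaternion_norm_def binary_norm_def by (simp only: char2_ring)
  moreover have "pol y\<^sub>0 y\<^sub>1 y\<^sub>2 y\<^sub>3 z\<^sub>0 z\<^sub>1 z\<^sub>2 z\<^sub>3 = quaternion_norm \<alpha> \<beta> y\<^sub>0 y\<^sub>1 y\<^sub>2 y\<^sub>3 * x\<^sub>1"
    unfolding pol_def z quaternion_norm_def binary_norm_def by (simp only: char2_ring)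
  moreover have "quaternion_norm \<alpha> \<beta> z\<^sub>0 z\<^sub>1 z\<^sub>2 z\<^sub>3
      = quaternion_norm \<alpha> \<beta> x\<^sub>0 x\<^sub>1 x\<^sub>2 x\<^sub>3 * quaternion_norm \<alpha> \<beta> y\<^sub>0 y\<^sub>1 y\<^sub>2 y\<^sub>3"
    unfolding z by (rule quaternion_norm_mult[symmetric])
  moreover have "pol x\<^sub>0 x\<^sub>1 x\<^sub>2 x\<^sub>3 y\<^sub>0 y\<^sub>1 y\<^sub>2 y\<^sub>3 = 0" and "z\<^sub>1 = 0"
    using orth by (simp_all add: pol_def z(2) x y)
  ultimately have "quaternion_norm \<alpha> \<beta> (a + b * x\<^sub>0 + c * y\<^sub>0 + d * z\<^sub>0) (b * x\<^sub>1 + c * y\<^sub>1 + d * z\<^sub>1)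
      (b * x\<^sub>2 + c * y\<^sub>2 + d * z\<^sub>2) (b * x\<^sub>3 + c * y\<^sub>3 + d * z\<^sub>3)
    = a\<^sup>2 + b\<^sup>2 * \<alpha>' + c\<^sup>2 * \<beta>' + d\<^sup>2 * (\<alpha>' * \<beta>') + a * b + c * d * \<beta>'"
    by (simp add: x y x_norm[unfolded x] y_norm[unfolded y])
  also have "\<dots> = quaternion_norm \<alpha>' \<beta>' a b c d"
    unfolding quaternion_norm_def binary_norm_def by (simp only: char2_ring)
  finally show ?thesis .
qed

text \<open>\<open>norm_form_of\<close> allows any presentation of the algebra. The change of basis
  from 1, x, y, x y to the standard basis of the model preserves the norm.\<close>

lemma pfister_isometric_if_presentation:
  assumes pres: "quaternion_presentation (quaternion_model \<alpha> \<beta>) \<alpha>' \<beta>' x y"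
    and \<beta>: "\<beta> \<noteq> (0::'a)"
  shows "pfister [\<beta>'] \<alpha>' \<cong>\<^sub>q pfister [\<beta>] \<alpha>"
proof -
  let ?A = "quaternion_model \<alpha> \<beta>"
  have ring: "ring ?A" and rels: "quaternion_rels ?A \<alpha>' \<beta>' x y"
    and bij: "inj (quaternion_elt ?A x y)"
    using pres unfolding quaternion_presentation_def F_algebra_def bij_betw_def by auto
  interpret A: ring ?A by (rule ring)
  obtain x\<^sub>0 x\<^sub>1 x\<^sub>2 x\<^sub>3 where x: "x = (x\<^sub>0, x\<^sub>1, x\<^sub>2, x\<^sub>3)"
    by (cases x) blast
  obtain y\<^sub>0 y\<^sub>1 y\<^sub>2 y\<^sub>3 where y: "y = (y\<^sub>0, y\<^sub>1, y\<^sub>2, y\<^sub>3)"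
    by (cases y) blast
  obtain z\<^sub>0 z\<^sub>1 z\<^sub>2 z\<^sub>3 where z: "x \<otimes>\<^bsub>?A\<^esub> y = (z\<^sub>0, z\<^sub>1, z\<^sub>2, z\<^sub>3)"
    by (cases "x \<otimes>\<^bsub>?A\<^esub> y") blast
  have elt: "quaternion_elt ?A x y (a, b, c, d) =
      (a + b * x\<^sub>0 + c * y\<^sub>0 + d * z\<^sub>0, b * x\<^sub>1 + c * y\<^sub>1 + d * z\<^sub>1,
       b * x\<^sub>2 + c * y\<^sub>2 + d * z\<^sub>2, b * x\<^sub>3 + c * y\<^sub>3 + d * z\<^sub>3)" for a b c d
    unfolding quaternion_elt_def z by (simp add: quaternion_model_def x y)
  have x_sq: "x \<otimes>\<^bsub>?A\<^esub> x \<oplus>\<^bsub>?A\<^esub> x = \<alpha>' \<odot>\<^bsub>?A\<^esub> \<one>\<^bsub>?A\<^esub>"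
    and y_sq: "y \<otimes>\<^bsub>?A\<^esub> y = \<beta>' \<odot>\<^bsub>?A\<^esub> \<one>\<^bsub>?A\<^esub>"
    and conj: "y \<otimes>\<^bsub>?A\<^esub> x \<otimes>\<^bsub>?A\<^esub> inv\<^bsub>?A\<^esub> y = x \<oplus>\<^bsub>?A\<^esub> \<one>\<^bsub>?A\<^esub>"
    and yU: "y \<in> Units ?A" and xC: "x \<in> carrier ?A"
    using rels unfolding quaternion_rels_def by auto
  have yx: "y \<otimes>\<^bsub>?A\<^esub> x = (x \<oplus>\<^bsub>?A\<^esub> \<one>\<^bsub>?A\<^esub>) \<otimes>\<^bsub>?A\<^esub> y"
    unfolding conj[symmetric]
    using A.m_assoc[OF A.m_closed[OF A.Units_closed[OF yU] xC] A.Units_inv_closed[OF yU]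
        A.Units_closed[OF yU]] A.Units_l_inv[OF yU] A.r_one[OF A.m_closed[OF A.Units_closed[OF yU] xC]]
    by simp
  \<comment> \<open>Second coordinate of the relation for x^2 + x; the first coordinate later gives
    the norm.\<close>
  have x1_sq: "x\<^sub>1 * x\<^sub>1 + x\<^sub>1 = 0"
  proof -
    have "x\<^sub>0 * x\<^sub>1 + x\<^sub>1 * x\<^sub>0 + x\<^sub>1 * x\<^sub>1 + \<beta> * (x\<^sub>2 * x\<^sub>3 + x\<^sub>3 * x\<^sub>2) + x\<^sub>1 = 0"
      using x_sq by (simp add: quaternion_model_def x)
    then show ?thesis by (simp only: char2_ring mult_zero_left mult_zero_right)
  qed
  have x1: "x\<^sub>1 = 1"
  proof (rule ccontr)
    \<comment> \<open>The trace would be 0 and x a scalar, contradicting independence of 1 and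
      x.\<close>
    assume "x\<^sub>1 \<noteq> 1"
    moreover have "x\<^sub>1 * (x\<^sub>1 + 1) = 0" using x1_sq by (simp add: distrib_left)
    ultimately have x10: "x\<^sub>1 = 0" using char2_eq_iff by auto
    have "x\<^sub>0 * x\<^sub>2 + x\<^sub>2 * x\<^sub>0 + x\<^sub>2 = 0" "x\<^sub>0 * x\<^sub>3 + x\<^sub>3 * x\<^sub>0 + x\<^sub>3 = 0"
      using x_sq x10 by (simp_all add: quaternion_model_def x)
    then have "x\<^sub>2 = 0" "x\<^sub>3 = 0" by (simp_all add: mult.commute char2_add)
    then have "quaternion_elt ?A x y (0, 1, 0, 0) = quaternion_elt ?A x y (x\<^sub>0, 0, 0, 0)"
      unfolding elt by (simp add: x10)
    from injD[OF bij this] show False by simp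
  qed
  have x_norm: "quaternion_norm \<alpha> \<beta> x\<^sub>0 x\<^sub>1 x\<^sub>2 x\<^sub>3 = \<alpha>'"
  proof -
    have "x\<^sub>0 * x\<^sub>0 + \<alpha> * x\<^sub>1 * x\<^sub>1 + \<beta> * (x\<^sub>2 * (x\<^sub>2 + x\<^sub>3) + \<alpha> * x\<^sub>3 * x\<^sub>3) + x\<^sub>0 = \<alpha>'"
      using x_sq by (simp add: quaternion_model_def x)
    then show ?thesis
      unfolding quaternion_norm_def binary_norm_def x1
      by (simp only: char2_ring mult_1_left mult_1_right mult_zero_left mult_zero_right)
  qed
  have y1: "y\<^sub>1 = 0"
  proof -
    have "y\<^sub>0 * y\<^sub>1 + y\<^sub>1 * y\<^sub>0 + y\<^sub>1 * y\<^sub>1 + \<beta> * (y\<^sub>2 * y\<^sub>3 + y\<^sub>3 * y\<^sub>2) = 0"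
      using y_sq by (simp add: quaternion_model_def y)
    then have "y\<^sub>1 * y\<^sub>1 = 0" by (simp only: char2_ring mult_zero_left mult_zero_right)
    then show ?thesis by simp
  qed
  have y_norm: "quaternion_norm \<alpha> \<beta> y\<^sub>0 y\<^sub>1 y\<^sub>2 y\<^sub>3 = \<beta>'"
  proof -
    have "y\<^sub>0 * y\<^sub>0 + \<alpha> * y\<^sub>1 * y\<^sub>1 + \<beta> * (y\<^sub>2 * (y\<^sub>2 + y\<^sub>3) + \<alpha> * y\<^sub>3 * y\<^sub>3) = \<beta>'"
      using y_sq by (simp add: quaternion_model_def y)
    then show ?thesis
      unfolding quaternion_norm_def binary_norm_def y1
      by (simp only: char2_ring mult_1_left mult_1_right mult_zero_left mult_zero_right)
  qed
  \<comment> \<open>First coordinate of y x = (x + 1) y.\<close>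
  have orth: "y\<^sub>0 + \<beta> * (x\<^sub>2 * y\<^sub>3 + x\<^sub>3 * y\<^sub>2) = 0"
  proof -
    have "y\<^sub>0 * x\<^sub>0 + \<alpha> * y\<^sub>1 * x\<^sub>1 + \<beta> * (y\<^sub>2 * (x\<^sub>2 + x\<^sub>3) + \<alpha> * y\<^sub>3 * x\<^sub>3)
        = (x\<^sub>0 + 1) * y\<^sub>0 + \<alpha> * x\<^sub>1 * y\<^sub>1 + \<beta> * (x\<^sub>2 * (y\<^sub>2 + y\<^sub>3) + \<alpha> * x\<^sub>3 * y\<^sub>3)"
      using yx by (simp add: quaternion_model_def x y)
    then have "y\<^sub>0 * x\<^sub>0 + \<alpha> * y\<^sub>1 * x\<^sub>1 + \<beta> * (y\<^sub>2 * (x\<^sub>2 + x\<^sub>3) + \<alpha> * y\<^sub>3 * x\<^sub>3)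
        + ((x\<^sub>0 + 1) * y\<^sub>0 + \<alpha> * x\<^sub>1 * y\<^sub>1 + \<beta> * (x\<^sub>2 * (y\<^sub>2 + y\<^sub>3) + \<alpha> * x\<^sub>3 * y\<^sub>3)) = 0"
      by (simp only: char2_add)
    moreover have "y\<^sub>0 * x\<^sub>0 + \<alpha> * y\<^sub>1 * x\<^sub>1 + \<beta> * (y\<^sub>2 * (x\<^sub>2 + x\<^sub>3) + \<alpha> * y\<^sub>3 * x\<^sub>3)
        + ((x\<^sub>0 + 1) * y\<^sub>0 + \<alpha> * x\<^sub>1 * y\<^sub>1 + \<beta> * (x\<^sub>2 * (y\<^sub>2 + y\<^sub>3) + \<alpha> * x\<^sub>3 * y\<^sub>3))
        = y\<^sub>0 + \<beta> * (x\<^sub>2 * y\<^sub>3 + x\<^sub>3 * y\<^sub>2)"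
      by (simp only: char2_ring mult_1_left mult_1_right)
    ultimately show ?thesis by simp
  qed
  have z_eq: "z\<^sub>0 = x\<^sub>0 * y\<^sub>0 + \<alpha> * x\<^sub>1 * y\<^sub>1 + \<beta> * (x\<^sub>2 * (y\<^sub>2 + y\<^sub>3) + \<alpha> * x\<^sub>3 * y\<^sub>3)"
      "z\<^sub>1 = x\<^sub>0 * y\<^sub>1 + x\<^sub>1 * y\<^sub>0 + x\<^sub>1 * y\<^sub>1 + \<beta> * (x\<^sub>2 * y\<^sub>3 + x\<^sub>3 * y\<^sub>2)"
      "z\<^sub>2 = x\<^sub>0 * y\<^sub>2 + \<alpha> * x\<^sub>1 * y\<^sub>3 + x\<^sub>2 * (y\<^sub>0 + y\<^sub>1) + \<alpha> * x\<^sub>3 * y\<^sub>1"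
      "z\<^sub>3 = x\<^sub>0 * y\<^sub>3 + x\<^sub>1 * y\<^sub>2 + x\<^sub>1 * y\<^sub>3 + x\<^sub>2 * y\<^sub>1 + x\<^sub>3 * y\<^sub>0"
    using z by (simp_all add: quaternion_model_def x y)
  define rows where "rows = [[1, x\<^sub>0, y\<^sub>0, z\<^sub>0], [0, x\<^sub>1, y\<^sub>1, z\<^sub>1], [0, x\<^sub>2, y\<^sub>2, z\<^sub>2], [0, x\<^sub>3, y\<^sub>3, z\<^sub>3]]"
  define P where "P = mat 4 4 (\<lambda>(i, j). rows ! i ! j)"
  have P: "P \<in> carrier_mat 4 4" by (simp add: P_def)
  have Pv: "(P *\<^sub>v v) $ 0 = v $ 0 + v $ 1 * x\<^sub>0 + v $ 2 * y\<^sub>0 + v $ 3 * z\<^sub>0"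
      "(P *\<^sub>v v) $ 1 = v $ 1 * x\<^sub>1 + v $ 2 * y\<^sub>1 + v $ 3 * z\<^sub>1"
      "(P *\<^sub>v v) $ 2 = v $ 1 * x\<^sub>2 + v $ 2 * y\<^sub>2 + v $ 3 * z\<^sub>2"
      "(P *\<^sub>v v) $ 3 = v $ 1 * x\<^sub>3 + v $ 2 * y\<^sub>3 + v $ 3 * z\<^sub>3"
    if "v \<in> carrier_vec 4" for v
    using that by (simp_all add: P_def rows_def scalar_prod_def eval_nat_numeral mult.commute)
  have inv: "invertible_mat P"
  proof (rule invertible_mat_if_injective[OF P])
    fix v :: "'a vec"
    assume v: "v \<in> carrier_vec 4" and Pv0: "P *\<^sub>v v = 0\<^sub>v 4"
    have "quaternion_elt ?A x y (v $ 0, v $ 1, v $ 2, v $ 3) = quaternion_elt ?A x y (0, 0, 0, 0)"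
      unfolding elt using Pv[OF v] unfolding Pv0 by simp
    then have "(v $ 0, v $ 1, v $ 2, v $ 3) = (0, 0, 0, 0)" by (rule injD[OF bij])
    moreover have "i = 0 \<or> i = 1 \<or> i = 2 \<or> i = 3" if "i < 4" for i :: nat using that by auto
    ultimately show "v = 0\<^sub>v 4" using v by (intro eq_vecI) auto
  qed
  have "qval (pfister [\<beta>] \<alpha>) (P *\<^sub>v v) = qval (pfister [\<beta>'] \<alpha>') v" if v: "v \<in> carrier_vec 4" for v
  proof -
    have "P *\<^sub>v v \<in> carrier_vec 4" using P v by simp
    then show ?thesis
      unfolding qval_pfister_1[OF v] qval_pfister_1[OF \<open>P *\<^sub>v v \<in> carrier_vec 4\<close>] Pv[OF v]
      by (intro quaternion_norm_change_generators[OF x1 y1 orth z_eq x_norm y_norm])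
  qed
  then show ?thesis unfolding isometric_def using P inv by auto
qed

text \<open>Linkage is applied to the models. Each norm form it supplies is isometric to the
  standard one, so the common factor passes to the slots in \<open>ps\<close>.\<close>

lemma norms_linked_if_all_quaternion_linked:
  assumes linked: "all_quaternion_linked (length ps) TYPE('a)"
    and nz: "\<And>\<alpha> \<beta>. (\<alpha>, \<beta>) \<in> set ps \<Longrightarrow> \<beta> \<noteq> (0::'a)"
  shows "norms_linked (set ps)"
proof -
  let ?Qs = "map (\<lambda>(\<alpha>, \<beta>). quaternion_model \<alpha> \<beta>) ps"
  have "\<forall>Q\<in>set ?Qs. quaternion_algebra Q"
  proof
    fix Q assume "Q \<in> set ?Qs"
    then obtain \<alpha> \<beta> where "(\<alpha>, \<beta>) \<in> set ps" "Q = quaternion_model \<alpha> \<beta>" by auto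
    then show "quaternion_algebra Q"
      using quaternion_presentation_exists[OF CHAR2 nz] unfolding quaternion_algebra_def by blast
  qed
  then have "linked ?Qs" using linked unfolding all_quaternion_linked_def by simp
  then obtain \<phi>s where norm: "list_all2 norm_form_of ?Qs \<phi>s" and common: "common_pfister_factor \<phi>s"
    unfolding linked_def by blast
  have \<phi>: "\<exists>\<phi>\<in>set \<phi>s. pfister [\<beta>] \<alpha> \<cong>\<^sub>q \<phi>" if mem: "(\<alpha>, \<beta>) \<in> set ps" for \<alpha> \<beta>
  proof -
    obtain i where i: "i < length ps" "ps ! i = (\<alpha>, \<beta>)" using mem by (metis in_set_conv_nth)
    have "norm_form_of (quaternion_model \<alpha> \<beta>) (\<phi>s ! i)" and len: "length \<phi>s = length ps"
      using norm i list_all2_nthD[OF norm, of i] list_all2_lengthD[OF norm] by auto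
    then obtain \<alpha>' \<beta>' x y where pres: "quaternion_presentation (quaternion_model \<alpha> \<beta>) \<alpha>' \<beta>' x y"
      and iso: "\<phi>s ! i \<cong>\<^sub>q pfister [\<beta>'] \<alpha>'"
      unfolding norm_form_of_def by blast
    have "pfister [\<beta>] \<alpha> \<cong>\<^sub>q \<phi>s ! i"
      using isometric_sym isometric_trans iso pfister_isometric_if_presentation[OF pres nz[OF mem]] by blast
    then show ?thesis using i len by auto
  qed
  have equiv: "norm_equiv \<alpha> \<beta> g e"
    if "pfister [\<beta>] \<alpha> \<cong>\<^sub>q \<phi>" "\<phi> \<cong>\<^sub>q diag_tensor [1, e] (binary_form 1 g)" for \<alpha> \<beta> g e :: 'a and \<phi>
    using norm_equiv_if_isometric isometric_trans[OF that] by (simp add: pfister_simps)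
  show ?thesis
    using common unfolding common_pfister_factor_def
  proof
    assume "\<exists>\<psi>. quadratic_pfister_1 \<psi> \<and>
        (\<forall>\<phi>\<in>set \<phi>s. \<exists>B. bilinear_pfister_1 B \<and> \<phi> \<cong>\<^sub>q diag_tensor B \<psi>)"
    then obtain g where g: "\<And>\<phi>. \<phi> \<in> set \<phi>s \<Longrightarrow>
        \<exists>e. e \<noteq> 0 \<and> \<phi> \<cong>\<^sub>q diag_tensor [1, e] (binary_form 1 g)"
      unfolding quadratic_pfister_1_def bilinear_pfister_1_def by blast
    have "\<exists>e. e \<noteq> 0 \<and> norm_equiv \<alpha> \<beta> g e" if "(\<alpha>, \<beta>) \<in> set ps" for \<alpha> \<beta>
      using \<phi>[OF that] g equiv by blast
    then show ?thesis unfolding norms_linked_def by blast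
  next
    assume "\<exists>B. bilinear_pfister_1 B \<and>
        (\<forall>\<phi>\<in>set \<phi>s. \<exists>\<psi>. quadratic_pfister_1 \<psi> \<and> \<phi> \<cong>\<^sub>q diag_tensor B \<psi>)"
    then obtain e where e: "e \<noteq> 0" and g: "\<And>\<phi>. \<phi> \<in> set \<phi>s \<Longrightarrow>
        \<exists>g. \<phi> \<cong>\<^sub>q diag_tensor [1, e] (binary_form 1 g)"
      unfolding quadratic_pfister_1_def bilinear_pfister_1_def by blast
    have "\<exists>g. norm_equiv \<alpha> \<beta> g e" if "(\<alpha>, \<beta>) \<in> set ps" for \<alpha> \<beta>
      using \<phi>[OF that] g equiv by blast
    then show ?thesis unfolding norms_linked_def using e by blast
  qed
qed

section \<open>Forms of dimension at least five\<close>

text \<open>In dimension at least 5 there are two orthogonal symplectic pairs and a further nonzero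
  vector orthogonal to them. After rescaling, \<open>q\<close> on their span is a multiple of the
  form in \<open>isotropic5\<close>.\<close>

lemma anisotropic_qdim_le_4:
  fixes q :: "'a qform"
  assumes iso: "\<And>a\<^sub>1 b\<^sub>1 a\<^sub>2 b\<^sub>2. b\<^sub>1 \<noteq> 0 \<Longrightarrow> b\<^sub>2 \<noteq> 0 \<Longrightarrow> isotropic5 a\<^sub>1 b\<^sub>1 a\<^sub>2 (b\<^sub>2::'a)"
    and q: "nonsingular q" and aniso: "anisotropic q"
  shows "qdim q \<le> 4"
proof (rule ccontr)
  define n where "n = qdim q"
  assume "\<not> qdim q \<le> 4"
  then have n: "n > 4" by (simp add: n_def)
  let ?V = "carrier_vec n :: 'a vec set"
  define B where "B = polar q"
  have B_add: "B (u + v) w = B u w + B v w" if "u \<in> ?V" "v \<in> ?V" "w \<in> ?V" for u v w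
    using that q unfolding nonsingular_def quadratic_form_def n_def B_def by auto
  have B_scale: "B (c \<cdot>\<^sub>v v) w = c * B v w" if "v \<in> ?V" "w \<in> ?V" for v w c
    using that q unfolding nonsingular_def quadratic_form_def n_def B_def by auto
  have B_sym: "B v w = B w v" if "v \<in> ?V" "w \<in> ?V" for v w
    using that comm_add_vec[of v n w] by (simp add: B_def polar_def)
  have B_add': "B w (u + v) = B w u + B w v" if "u \<in> ?V" "v \<in> ?V" "w \<in> ?V" for u v w
    using that B_add B_sym[of w] by simp
  have B_scale': "B w (c \<cdot>\<^sub>v v) = c * B w v" if "v \<in> ?V" "w \<in> ?V" for v w c
    using that B_scale B_sym[of w] by simp
  have q_scale: "qval q (c \<cdot>\<^sub>v v) = c\<^sup>2 * qval q v" if "v \<in> ?V" for c v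
    using that q unfolding nonsingular_def quadratic_form_def n_def by auto
  have q_add: "qval q (v + w) = qval q v + qval q w + B v w" for v w
    by (simp add: B_def polar_def)
  have B_self: "B v v = 0" if v: "v \<in> ?V" for v
  proof -
    have "v + v = 0 \<cdot>\<^sub>v v" using v by (intro eq_vecI) (auto simp: char2_add)
    then have "qval q (v + v) = 0" using q_scale[OF v, of 0] by simp
    then show ?thesis by (simp add: B_def polar_def char2_diff char2_add)
  qed
  have q_nz: "qval q v \<noteq> 0" if "v \<in> ?V" "v \<noteq> 0\<^sub>v n" for v
    using that aniso unfolding anisotropic_def n_def by auto
  have orth: "\<exists>v\<in>?V. v \<noteq> 0\<^sub>v n \<and> (\<forall>w\<in>set ws. B v w = 0)" if ws: "set ws \<subseteq> ?V" "length ws < n" for ws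
  proof -
    have lin: "linear_functional (\<lambda>c. B (vec n c) w)" if "w \<in> ?V" for w
      unfolding linear_functional_def
    proof (intro conjI allI)
      fix c d :: "nat \<Rightarrow> 'a" and k
      have "vec n (\<lambda>i. c i + d i) = vec n c + vec n d" "vec n (\<lambda>i. k * c i) = k \<cdot>\<^sub>v vec n c"
        by (intro eq_vecI; simp)+
      then show "B (vec n (\<lambda>i. c i + d i)) w = B (vec n c) w + B (vec n d) w"
        "B (vec n (\<lambda>i. k * c i)) w = k * B (vec n c) w"
        using that B_add B_scale by simp_all
    qed
    obtain c where c: "\<And>r. r \<in> set (map (\<lambda>w c. B (vec n c) w) ws) \<Longrightarrow> r c = 0"
      "\<And>i. i \<notin> {..<n} \<Longrightarrow> c i = 0" "\<exists>i. c i \<noteq> 0"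
      by (rule common_kernel_nontrivial[of "map (\<lambda>w c. B (vec n c) w) ws" "{..<n}"])
        (use lin ws in auto)
    then obtain i where "c i \<noteq> 0" "i < n" by (metis lessThan_iff)
    then have "vec n c \<noteq> 0\<^sub>v n" by (metis index_vec index_zero_vec(1))
    then show ?thesis using c(1) by (intro bexI[of _ "vec n c"]) auto
  qed
  have partner: "\<exists>w\<in>?V. B v w = 1" if v: "v \<in> ?V" "v \<noteq> 0\<^sub>v n" for v
  proof -
    have "\<forall>v\<in>?V. (\<forall>w\<in>?V. B v w = 0) \<longrightarrow> v = 0\<^sub>v n"
      using q unfolding nonsingular_def n_def B_def by (rule conjunct2)
    then obtain w where w: "w \<in> ?V" "B v w \<noteq> 0" using v by blast
    then have "B v ((1 / B v w) \<cdot>\<^sub>v w) = 1"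
      using B_scale'[OF w(1) v(1), of "1 / B v w"] by simp
    then show ?thesis using w by (intro bexI[of _ "(1 / B v w) \<cdot>\<^sub>v w"]) auto
  qed
  obtain e\<^sub>1 where e1: "e\<^sub>1 \<in> ?V" "e\<^sub>1 \<noteq> 0\<^sub>v n" using orth[of "[]"] n by auto
  obtain f\<^sub>1 where f1: "f\<^sub>1 \<in> ?V" "B e\<^sub>1 f\<^sub>1 = 1" using partner[OF e1] by blast
  obtain e\<^sub>2 where e2: "e\<^sub>2 \<in> ?V" "e\<^sub>2 \<noteq> 0\<^sub>v n" "B e\<^sub>2 e\<^sub>1 = 0" "B e\<^sub>2 f\<^sub>1 = 0"
    using orth[of "[e\<^sub>1, f\<^sub>1]"] n e1 f1 by auto
  obtain h where h: "h \<in> ?V" "B e\<^sub>2 h = 1" using partner[OF e2(1,2)] by blast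
  \<comment> \<open>Subtracts from \<open>h\<close> its component in the first symplectic
    plane.\<close>
  define f\<^sub>2 where "f\<^sub>2 = h + (B h f\<^sub>1 \<cdot>\<^sub>v e\<^sub>1 + B h e\<^sub>1 \<cdot>\<^sub>v f\<^sub>1)"
  have f2: "f\<^sub>2 \<in> ?V" using h e1 f1 by (simp add: f\<^sub>2_def)
  have sym: "B f\<^sub>1 e\<^sub>1 = 1" using B_sym e1 f1 by simp
  have f2B: "B e\<^sub>2 f\<^sub>2 = 1" "B f\<^sub>2 e\<^sub>1 = 0" "B f\<^sub>2 f\<^sub>1 = 0"
    using h e1 f1 e2 sym
    by (simp_all add: f\<^sub>2_def B_add B_add' B_scale B_scale' B_self char2_add)
  obtain e\<^sub>3 where e3: "e\<^sub>3 \<in> ?V" "e\<^sub>3 \<noteq> 0\<^sub>v n" "B e\<^sub>3 e\<^sub>1 = 0" "B e\<^sub>3 f\<^sub>1 = 0" "B e\<^sub>3 e\<^sub>2 = 0" "B e\<^sub>3 f\<^sub>2 = 0"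
    using orth[of "[e\<^sub>1, f\<^sub>1, e\<^sub>2, f\<^sub>2]"] n e1 f1 e2 f2 by auto
  define a\<^sub>1 where "a\<^sub>1 = qval q e\<^sub>1"
  define a\<^sub>2 where "a\<^sub>2 = qval q e\<^sub>2"
  define a\<^sub>3 where "a\<^sub>3 = qval q e\<^sub>3"
  define b\<^sub>1 where "b\<^sub>1 = qval q f\<^sub>1"
  define b\<^sub>2 where "b\<^sub>2 = qval q f\<^sub>2"
  have a: "a\<^sub>1 \<noteq> 0" "a\<^sub>2 \<noteq> 0" "a\<^sub>3 \<noteq> 0"
    using q_nz e1 e2 e3 by (simp_all add: a\<^sub>1_def a\<^sub>2_def a\<^sub>3_def)
  \<comment> \<open>Replacing the second vector of each pair by \<open>a\<^sub>i\<close> times it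
    turns [\<open>a\<^sub>i\<close>, \<open>b\<^sub>i\<close>] into \<open>a\<^sub>i\<close>
    [1, \<open>a\<^sub>i b\<^sub>i\<close>]; dividing by \<open>a\<^sub>3\<close> normalises the
    last coefficient to 1.\<close>
  have "isotropic5 (a\<^sub>1 * b\<^sub>1) (a\<^sub>1 / a\<^sub>3) (a\<^sub>2 * b\<^sub>2) (a\<^sub>2 / a\<^sub>3)"
    by (rule iso) (use a in simp_all)
  then obtain x\<^sub>1 y\<^sub>1 x\<^sub>2 y\<^sub>2 t where nz: "x\<^sub>1 \<noteq> 0 \<or> y\<^sub>1 \<noteq> 0 \<or> x\<^sub>2 \<noteq> 0 \<or> y\<^sub>2 \<noteq> 0 \<or> t \<noteq> 0"
    and eq: "(a\<^sub>1 / a\<^sub>3) * binary_norm (a\<^sub>1 * b\<^sub>1) x\<^sub>1 y\<^sub>1 + (a\<^sub>2 / a\<^sub>3) * binary_norm (a\<^sub>2 * b\<^sub>2) x\<^sub>2 y\<^sub>2 + t\<^sup>2 = 0"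
    unfolding isotropic5_def by blast
  define u where "u = x\<^sub>1 \<cdot>\<^sub>v e\<^sub>1 + ((a\<^sub>1 * y\<^sub>1) \<cdot>\<^sub>v f\<^sub>1 + (x\<^sub>2 \<cdot>\<^sub>v e\<^sub>2 + ((a\<^sub>2 * y\<^sub>2) \<cdot>\<^sub>v f\<^sub>2 + t \<cdot>\<^sub>v e\<^sub>3)))"
  have u: "u \<in> ?V" using e1 f1 e2 f2 e3 by (simp add: u_def)
  have B0: "B e\<^sub>1 e\<^sub>2 = 0" "B f\<^sub>1 e\<^sub>2 = 0" "B e\<^sub>1 f\<^sub>2 = 0" "B f\<^sub>1 f\<^sub>2 = 0"
    "B e\<^sub>1 e\<^sub>3 = 0" "B f\<^sub>1 e\<^sub>3 = 0" "B e\<^sub>2 e\<^sub>3 = 0" "B f\<^sub>2 e\<^sub>3 = 0" "B f\<^sub>2 e\<^sub>2 = 1"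
    using B_sym e1 f1 e2 f2 f2B e3 by simp_all
  have "qval q u = a\<^sub>1 * x\<^sub>1\<^sup>2 + a\<^sub>1 * x\<^sub>1 * y\<^sub>1 + b\<^sub>1 * (a\<^sub>1 * y\<^sub>1)\<^sup>2
      + (a\<^sub>2 * x\<^sub>2\<^sup>2 + a\<^sub>2 * x\<^sub>2 * y\<^sub>2 + b\<^sub>2 * (a\<^sub>2 * y\<^sub>2)\<^sup>2) + a\<^sub>3 * t\<^sup>2"
    unfolding u_def using e1(1) f1 e2(1,3,4) f2 f2B e3(1,3-) B0
    by (simp add: q_add q_scale B_add B_add' B_scale B_scale' a\<^sub>1_def a\<^sub>2_def a\<^sub>3_def b\<^sub>1_def b\<^sub>2_def)
  also have "\<dots> = a\<^sub>1 * binary_norm (a\<^sub>1 * b\<^sub>1) x\<^sub>1 y\<^sub>1 + a\<^sub>2 * binary_norm (a\<^sub>2 * b\<^sub>2) x\<^sub>2 y\<^sub>2 + a\<^sub>3 * t\<^sup>2"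
    unfolding binary_norm_def by (simp only: char2_ring)
  also have "\<dots> = a\<^sub>3 * ((a\<^sub>1 / a\<^sub>3) * binary_norm (a\<^sub>1 * b\<^sub>1) x\<^sub>1 y\<^sub>1
      + (a\<^sub>2 / a\<^sub>3) * binary_norm (a\<^sub>2 * b\<^sub>2) x\<^sub>2 y\<^sub>2 + t\<^sup>2)"
    using a(3) by (simp add: distrib_left)
  finally have "qval q u = 0" using eq by simp
  then have "u = 0\<^sub>v n" using q_nz[OF u] by blast
  then have B_u: "B u w = 0" if "w \<in> ?V" for w
  proof -
    have "0 \<cdot>\<^sub>v u = u" unfolding \<open>u = 0\<^sub>v n\<close> by (rule eq_vecI) simp_all
    then show ?thesis using B_scale[OF u that, of 0] by simp
  qed
  \<comment> \<open>The partner vectors read off four coordinates of \<open>u = 0\<close>; then t^2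
    = 0 by the isotropy equation.\<close>
  have "B u f\<^sub>1 = x\<^sub>1" "B u e\<^sub>1 = a\<^sub>1 * y\<^sub>1" "B u f\<^sub>2 = x\<^sub>2" "B u e\<^sub>2 = a\<^sub>2 * y\<^sub>2"
    unfolding u_def using e1(1) f1 e2(1,3,4) f2 f2B e3(1,3-) B0 sym
    by (simp_all add: B_add B_scale B_self)
  then have xy: "x\<^sub>1 = 0" "y\<^sub>1 = 0" "x\<^sub>2 = 0" "y\<^sub>2 = 0"
    using B_u[OF f1(1)] B_u[OF e1(1)] B_u[OF f2] B_u[OF e2(1)] a by simp_all
  then have "t = 0" using eq by simp
  then show False using nz xy by simp
qed

lemma u_invariant_le_4:
  assumes linked: "\<And>a\<^sub>1 b\<^sub>1 a\<^sub>2 b\<^sub>2. b\<^sub>1 \<noteq> 0 \<Longrightarrow> b\<^sub>2 \<noteq> 0 \<Longrightarrow> norms_linked {(a\<^sub>1, b\<^sub>1), (a\<^sub>2, b\<^sub>2::'a)}"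
    and iso: "\<And>\<alpha> \<beta> \<gamma>. \<beta> \<noteq> 0 \<Longrightarrow> \<gamma> \<noteq> 0 \<Longrightarrow> pfister3_isotropic \<alpha> \<beta> (\<gamma>::'a)"
  shows "u_invariant TYPE('a) \<le> 4"
  unfolding u_invariant_def
proof (rule Sup_least)
  fix d
  assume "d \<in> {enat (qdim q) |q :: 'a qform. nonsingular q \<and> anisotropic q \<and>
      (\<exists>n::nat. n > 0 \<and> witt_class q [^]\<^bsub>witt_group\<^esub> n = \<one>\<^bsub>witt_group\<^esub>)}"
  then obtain q :: "'a qform" where d: "d = enat (qdim q)" and q: "nonsingular q" "anisotropic q"
    by blast
  have "qdim q \<le> 4"
    by (rule anisotropic_qdim_le_4[OF isotropic5_if_norms_linked[OF iso linked] q])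
  then show "d \<le> 4" unfolding d by (simp add: numeral_eq_enat)
qed

end

theorem corollary4p5:
  assumes "CHAR('a::field) = 2"
  shows "(linked_field TYPE('a) \<and> (I3q :: 'a qform set set) = {\<one>\<^bsub>witt_group\<^esub>}
            \<longrightarrow> u_invariant TYPE('a) \<le> 4) \<and>
         (all_quaternion_linked 3 TYPE('a) \<longrightarrow> u_invariant TYPE('a) \<le> 4)"
proof (intro conjI impI)
  interpret char2_field "TYPE('a)" by (rule char2_field.intro) (rule assms)
  show "u_invariant TYPE('a) \<le> 4"
    if F: "linked_field TYPE('a) \<and> (I3q :: 'a qform set set) = {\<one>\<^bsub>witt_group\<^esub>}"
  proof (rule u_invariant_le_4)
    fix a\<^sub>1 b\<^sub>1 a\<^sub>2 b\<^sub>2 :: 'a assume "b\<^sub>1 \<noteq> 0" "b\<^sub>2 \<noteq> 0"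
    moreover have "all_quaternion_linked (length [(a\<^sub>1, b\<^sub>1), (a\<^sub>2, b\<^sub>2)]) TYPE('a)"
      using F by (simp add: linked_field_def numeral_2_eq_2)
    ultimately show "norms_linked {(a\<^sub>1, b\<^sub>1), (a\<^sub>2, b\<^sub>2)}"
      using norms_linked_if_all_quaternion_linked[of "[(a\<^sub>1, b\<^sub>1), (a\<^sub>2, b\<^sub>2)]"] by auto
  qed (rule pfister3_isotropic_if_I3q_trivial[OF conjunct2[OF F]])
  show "u_invariant TYPE('a) \<le> 4" if F: "all_quaternion_linked 3 TYPE('a)"
  proof -
    have triple: "norms_linked {(a\<^sub>1, b\<^sub>1), (a\<^sub>2, b\<^sub>2), (a\<^sub>3, b\<^sub>3)}"
      if "b\<^sub>1 \<noteq> 0" "b\<^sub>2 \<noteq> 0" "b\<^sub>3 \<noteq> 0" for a\<^sub>1 b\<^sub>1 a\<^sub>2 b\<^sub>2 a\<^sub>3 b\<^sub>3 :: 'a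
    proof -
      have "all_quaternion_linked (length [(a\<^sub>1, b\<^sub>1), (a\<^sub>2, b\<^sub>2), (a\<^sub>3, b\<^sub>3)]) TYPE('a)"
        using F by (simp add: numeral_3_eq_3)
      then show ?thesis
        using norms_linked_if_all_quaternion_linked[of "[(a\<^sub>1, b\<^sub>1), (a\<^sub>2, b\<^sub>2), (a\<^sub>3, b\<^sub>3)]"] that
        by auto
    qed
    show ?thesis
    proof (rule u_invariant_le_4)
      show "norms_linked {(a\<^sub>1, b\<^sub>1), (a\<^sub>2, b\<^sub>2)}" if "b\<^sub>1 \<noteq> 0" "b\<^sub>2 \<noteq> 0" for a\<^sub>1 b\<^sub>1 a\<^sub>2 b\<^sub>2 :: 'a
        \<comment> \<open>Repeating the second algebra collapses a linked triple to the
          pair.\<close>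
        using triple[OF that that(2), of a\<^sub>1 a\<^sub>2 a\<^sub>2] by simp
    qed (rule pfister3_isotropic_if_triples_linked[OF triple])
  qed
qed

end
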